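(* Let $\mathcal{T}$ be a first-order theory with satisfaction relation $\models_{\mathcal{T}}$. Let $P=(v,\mathit{init}(v),\mathit{next}(v,v'))$ be a program and let $\varphi$ be a CTL+FO formula in which no first-order-bound variable shadows another variable. Then the constraint sequence $\textsc{Gen}(\varphi, v, \mathit{init}(v), \mathit{next}(v,v'))$ (defined in the context) is satisfiable if and only if $P\models\varphi$.
   Context: Programs. A program $P$ consists of a tuple of variables $v$, an initial condition $\mathit{init}(v)$ and a transition relation $\mathit{next}(v,v')$, both assertions of $\mathcal{T}$. A state is a valuation of $v$. For a state $s$, $\Pi_P(s)$ is the set of maximal sequences of states $s_1,s_2,\ldots$ (finite or infinite) with $s_1=s$ and $\mathit{next}(s_i,s_{i+1})$ for all consecutive pairs. CTL+FO syntax (c ranges over $\mathcal{T}$-assertions, $x$ over variables): state formulas $\varphi ::= \forall x:\varphi \mid \exists x:\varphi \mid c \mid \varphi\land\varphi \mid \varphi\lor\varphi \mid \mathsf{A}\,\phi \mid \mathsf{E}\,\phi$; path formulas $\phi ::= \mathsf{X}\varphi \mid \mathsf{G}\varphi \mid \varphi\,\mathsf{U}\,\varphi$; and $\mathsf{F}\varphi := \mathit{true}\,\mathsf{U}\,\varphi$. Semantics: $P\models\varphi$ iff $P,s\models\varphi$ for every $s$ with $\mathit{init}(s)$, where: $P,s\models\forall x:\varphi$ iff $P,s\models\varphi[x\mapsto d]$ for all values $d$; $P,s\models\exists x:\varphi$ iff this holds for some $d$; $P,s\models c$ iff $s\models_{\mathcal{T}} c$; $\land,\lor$ as usual; $P,s\models\mathsf{A}\phi$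 (resp. $\mathsf{E}\phi$) iff $P,\pi\models\phi$ for all (resp. some) $\pi\in\Pi_P(s)$; for $\pi=s_1,s_2,\ldots$: $P,\pi\models\mathsf{X}\varphi$ iff $s_2$ exists and $P,s_2\models\varphi$; $P,\pi\models\mathsf{G}\varphi$ iff $P,s_i\models\varphi$ for all $i\ge1$; $P,\pi\models\varphi_1\mathsf{U}\varphi_2$ iff there is $j\ge1$ with $P,s_j\models\varphi_2$ and $P,s_i\models\varphi_1$ for all $1\le i<j$. Constraints. $\textsc{Gen}$ produces a finite sequence of constraints over fresh predicate symbols ("query symbols"). Each constraint is either an implication between formulas (free variables implicitly universally quantified; existential quantifiers allowed on the right) or $\mathit{wf}(\mathit{rank})$. The sequence is satisfiable iff there is an interpretation of all query symbols as relations of the appropriate arity such that every implication is valid in $\mathcal{T}$ and for every $\mathit{wf}(\mathit{rank})$ the interpretation of $\mathit{rank}$ is a well-founded relation (no infinite chain $u_1,u_2,\ldots$ with $\mathit{rank}(u_i,u_{i+1})$ for all $i$). "," denotes concatenation of sequences. Definition of $\textsc{Gen}(\varphi_0,v_0,\mathit{init}(v_0),\mathit{next}(v_0,v_0'))$ by cases on $\varphi_0$: - $\forall x:\varphi_1$: with $v_1=(v_0,x)$, return $\textsc{Gen}(\varphi_1,v_1,\mathit{init}(v_0),\mathit{next}(v_0,v_0')\land x'=x)$. - $\exists x:\varphi_1$: with $v_1=(v_0,x)$ and fresh $\mathit{aux}$ of arity $|v_1|$, return $\mathit{init}(v_0)\to\exists x:\mathit{aux}(v_1)$, $\textsc{Gen}(\varphi_1,v_1,\mathit{aux}(v_1),\mathit{next}(v_0,v_0')\land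 x'=x)$. - $c$: return $\mathit{init}(v_0)\to c$. - $\mathsf{E}\mathsf{F}\varphi_1$: fresh $\mathit{inv},\mathit{aux}$ of arity $|v_0|$, $\mathit{rank}$ of arity $2|v_0|$; return $\mathit{init}(v_0)\to\mathit{inv}(v_0)$, $\mathit{inv}(v_0)\land\neg\mathit{aux}(v_0)\to\exists v_0':\mathit{next}(v_0,v_0')\land\mathit{inv}(v_0')\land\mathit{rank}(v_0,v_0')$, $\mathit{wf}(\mathit{rank})$, $\textsc{Gen}(\varphi_1,v_0,\mathit{aux}(v_0),\mathit{next}(v_0,v_0'))$. - $\mathsf{A}\mathsf{X}\varphi_1$: fresh $\mathit{aux}$; return $\mathit{init}(v_0)\to\exists v_0':\mathit{next}(v_0,v_0')$, $\mathit{init}(v_0)\land\mathit{next}(v_0,v_0')\to\mathit{aux}(v_0')$, $\textsc{Gen}(\varphi_1,v_0,\mathit{aux}(v_0),\mathit{next}(v_0,v_0'))$. - $\mathsf{E}\mathsf{X}\varphi_1$: fresh $\mathit{aux}$; return $\mathit{init}(v_0)\to\exists v_0':\mathit{next}(v_0,v_0')\land\mathit{aux}(v_0')$, $\textsc{Gen}(\varphi_1,v_0,\mathit{aux}(v_0),\mathit{next}(v_0,v_0'))$. - $\mathsf{A}\mathsf{G}\varphi_1$: fresh $\mathit{inv}$; return $\mathit{init}(v_0)\to\mathit{inv}(v_0)$, $\mathit{inv}(v_0)\land\mathit{next}(v_0,v_0')\to\mathit{inv}(v_0')$, $\textsc{Gen}(\varphi_1,v_0,\mathit{inv}(v_0),\mathit{next}(v_0,v_0'))$.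 - $\mathsf{E}\mathsf{G}\varphi_1$: fresh $\mathit{inv}$; return $\mathit{init}(v_0)\to\mathit{inv}(v_0)$, $\mathit{inv}(v_0)\land\mathit{next}(v_0,v_0')\to\exists v_0':\mathit{next}(v_0,v_0')\land\mathit{inv}(v_0')$, $\textsc{Gen}(\varphi_1,v_0,\mathit{inv}(v_0),\mathit{next}(v_0,v_0'))$. - $\mathsf{A}(\varphi_1\mathsf{U}\varphi_2)$: fresh $\mathit{inv},\mathit{aux}_1,\mathit{aux}_2$ of arity $|v_0|$, $\mathit{rank}$ of arity $2|v_0|$; return $\mathit{init}(v_0)\to\mathit{inv}(v_0)$, $\mathit{inv}(v_0)\land\neg\mathit{aux}_2(v_0)\to\mathit{aux}_1(v_0)\land\exists v_0':\mathit{next}(v_0,v_0')$, $\mathit{inv}(v_0)\land\neg\mathit{aux}_2(v_0)\land\mathit{next}(v_0,v_0')\to\mathit{inv}(v_0')\land\mathit{rank}(v_0,v_0')$, $\mathit{wf}(\mathit{rank})$, $\textsc{Gen}(\varphi_1,v_0,\mathit{aux}_1(v_0),\mathit{next}(v_0,v_0'))$, $\textsc{Gen}(\varphi_2,v_0,\mathit{aux}_2(v_0),\mathit{next}(v_0,v_0'))$. - $\mathsf{E}(\varphi_1\mathsf{U}\varphi_2)$: same fresh symbols; return $\mathit{init}(v_0)\to\mathit{inv}(v_0)$, $\mathit{inv}(v_0)\land\neg\mathit{aux}_2(v_0)\to\mathit{aux}_1(v_0)\land\exists v_0':\mathit{next}(v_0,v_0')\land\mathit{inv}(v_0')\land\mathit{rank}(v_0,v_0')$,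 $\mathit{wf}(\mathit{rank})$, $\textsc{Gen}(\varphi_1,v_0,\mathit{aux}_1(v_0),\mathit{next}(v_0,v_0'))$, $\textsc{Gen}(\varphi_2,v_0,\mathit{aux}_2(v_0),\mathit{next}(v_0,v_0'))$. - $\mathsf{A}\mathsf{F}\varphi_1$: treated as $\mathsf{A}(\mathit{true}\,\mathsf{U}\,\varphi_1)$. - $\varphi_1\land\varphi_2$ (resp. $\varphi_1\lor\varphi_2$): fresh $\mathit{aux}_1,\mathit{aux}_2$; return $\mathit{init}(v_0)\to\mathit{aux}_1(v_0)\land\mathit{aux}_2(v_0)$ (resp. $\lor$), $\textsc{Gen}(\varphi_1,v_0,\mathit{aux}_1(v_0),\mathit{next}(v_0,v_0'))$, $\textsc{Gen}(\varphi_2,v_0,\mathit{aux}_2(v_0),\mathit{next}(v_0,v_0'))$. All symbols introduced are fresh (distinct from all others). *)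

theory Defs
  imports Main
begin

section \<open>First-order assertions\<close>

datatype ('f, vars_trm: 'v) trm =
    Var 'v
  | Fn 'f "('f, 'v) trm list"

datatype ('f, 'p, 'v) fm =
    TrueF
  | EqF "('f, 'v) trm" "('f, 'v) trm"
  | PredF 'p "('f, 'v) trm list"
  | NotF "('f, 'p, 'v) fm"
  | AndF "('f, 'p, 'v) fm" "('f, 'p, 'v) fm"
  | OrF "('f, 'p, 'v) fm" "('f, 'p, 'v) fm"
  | AllF 'v "('f, 'p, 'v) fm"
  | ExF 'v "('f, 'p, 'v) fm"

primrec fv :: "('f, 'p, 'v) fm \<Rightarrow> 'v set" where
  "fv TrueF = {}"
| "fv (EqF s t) = vars_trm s \<union> vars_trm t"
| "fv (PredF p ts) = (\<Union>t\<in>set ts. vars_trm t)"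
| "fv (NotF a) = fv a"
| "fv (AndF a b) = fv a \<union> fv b"
| "fv (OrF a b) = fv a \<union> fv b"
| "fv (AllF x a) = fv a - {x}"
| "fv (ExF x a) = fv a - {x}"

text \<open>
  The theory enters through the structure in which its assertions are evaluated; the domain of
  values is the whole type \<open>'d\<close>. A theory given by axioms is covered by taking any of its models.
  Symbols carry no declared arity: they are interpreted on
  argument lists of every length, which subsumes any signature with arities.
\<close>

record ('f, 'p, 'd) struct =
  fn_int :: "'f \<Rightarrow> 'd list \<Rightarrow> 'd"
  pred_int :: "'p \<Rightarrow> 'd list \<Rightarrow> bool"

primrec eval :: "('f, 'p, 'd) struct \<Rightarrow> ('v \<Rightarrow> 'd) \<Rightarrow> ('f, 'v) trm \<Rightarrow> 'd" where
  "eval T \<sigma> (Var x) = \<sigma> x"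
| "eval T \<sigma> (Fn f ts) = fn_int T f (map (eval T \<sigma>) ts)"

primrec holds :: "('f, 'p, 'd) struct \<Rightarrow> ('v \<Rightarrow> 'd) \<Rightarrow> ('f, 'p, 'v) fm \<Rightarrow> bool" where
  "holds T \<sigma> TrueF \<longleftrightarrow> True"
| "holds T \<sigma> (EqF s t) \<longleftrightarrow> eval T \<sigma> s = eval T \<sigma> t"
| "holds T \<sigma> (PredF p ts) \<longleftrightarrow> pred_int T p (map (eval T \<sigma>) ts)"
| "holds T \<sigma> (NotF a) \<longleftrightarrow> \<not> holds T \<sigma> a"
| "holds T \<sigma> (AndF a b) \<longleftrightarrow> holds T \<sigma> a \<and> holds T \<sigma> b"
| "holds T \<sigma> (OrF a b) \<longleftrightarrow> holds T \<sigma> a \<or> holds T \<sigma> b"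
| "holds T \<sigma> (AllF x a) \<longleftrightarrow> (\<forall>d. holds T (\<sigma>(x := d)) a)"
| "holds T \<sigma> (ExF x a) \<longleftrightarrow> (\<exists>d. holds T (\<sigma>(x := d)) a)"


section \<open>Programs\<close>

datatype 'x pvar = Unprimed 'x | Primed 'x

record ('f, 'p, 'x) program =
  pvars :: "'x list"
  pinit :: "('f, 'p, 'x) fm"
  pnext :: "('f, 'p, 'x pvar) fm"

definition wf_program :: "('f, 'p, 'x) program \<Rightarrow> bool" where
  "wf_program P \<longleftrightarrow>
     fv (pinit P) \<subseteq> set (pvars P) \<and>
     fv (pnext P) \<subseteq> Unprimed ` set (pvars P) \<union> Primed ` set (pvars P)"

text \<open>
  A valuation of \<open>v\<close> is a function that is \<^const>\<open>undefined\<close> outside \<open>v\<close>, so that distinct states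
  differ on some program variable.
\<close>

definition states :: "('f, 'p, 'x) program \<Rightarrow> ('x \<Rightarrow> 'd) set" where
  "states P = {s. \<forall>x. x \<notin> set (pvars P) \<longrightarrow> s x = undefined}"

definition initial :: "('f, 'p, 'd) struct \<Rightarrow> ('f, 'p, 'x) program \<Rightarrow> ('x \<Rightarrow> 'd) \<Rightarrow> bool" where
  "initial T P s \<longleftrightarrow> s \<in> states P \<and> holds T s (pinit P)"

definition step ::
  "('f, 'p, 'd) struct \<Rightarrow> ('f, 'p, 'x) program \<Rightarrow> ('x \<Rightarrow> 'd) \<Rightarrow> ('x \<Rightarrow> 'd) \<Rightarrow> bool" where
  "step T P s s' \<longleftrightarrow>
     s \<in> states P \<and> s' \<in> states P \<and> holds T (case_pvar s s') (pnext P)"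

text \<open>
  Finite and infinite sequences are partial functions on \<^typ>\<open>nat\<close> (counting from 0) whose domain
  is downward closed; the extension order is then \<open>\<subseteq>\<^sub>m\<close>.
\<close>

definition execution ::
  "('f, 'p, 'd) struct \<Rightarrow> ('f, 'p, 'x) program \<Rightarrow> ('x \<Rightarrow> 'd) \<Rightarrow> (nat \<rightharpoonup> ('x \<Rightarrow> 'd)) \<Rightarrow> bool" where
  "execution T P s \<pi> \<longleftrightarrow>
     s \<in> states P \<and> \<pi> 0 = Some s \<and>
     (\<forall>i t. \<pi> (Suc i) = Some t \<longrightarrow> (\<exists>r. \<pi> i = Some r \<and> step T P r t))"

definition paths ::
  "('f, 'p, 'd) struct \<Rightarrow> ('f, 'p, 'x) program \<Rightarrow> ('x \<Rightarrow> 'd) \<Rightarrow> (nat \<rightharpoonup> ('x \<Rightarrow> 'd)) set" where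
  "paths T P s =
     {\<pi>. execution T P s \<pi> \<and> (\<forall>\<pi>'. execution T P s \<pi>' \<and> \<pi> \<subseteq>\<^sub>m \<pi>' \<longrightarrow> \<pi>' = \<pi>)}"


section \<open>CTL+FO\<close>

datatype ('f, 'p, 'x) sform =
    Forall 'x "('f, 'p, 'x) sform"
  | Exists 'x "('f, 'p, 'x) sform"
  | Assn "('f, 'p, 'x) fm"
  | Conj "('f, 'p, 'x) sform" "('f, 'p, 'x) sform"
  | Disj "('f, 'p, 'x) sform" "('f, 'p, 'x) sform"
  | A "('f, 'p, 'x) pform"
  | E "('f, 'p, 'x) pform"
and ('f, 'p, 'x) pform =
    X "('f, 'p, 'x) sform"
  | G "('f, 'p, 'x) sform"
  | U "('f, 'p, 'x) sform" "('f, 'p, 'x) sform"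

abbreviation F :: "('f, 'p, 'x) sform \<Rightarrow> ('f, 'p, 'x) pform" where
  "F \<phi> \<equiv> U (Assn TrueF) \<phi>"

primrec fv_sform :: "('f, 'p, 'x) sform \<Rightarrow> 'x set"
  and fv_pform :: "('f, 'p, 'x) pform \<Rightarrow> 'x set" where
  "fv_sform (Forall x \<phi>) = fv_sform \<phi> - {x}"
| "fv_sform (Exists x \<phi>) = fv_sform \<phi> - {x}"
| "fv_sform (Assn c) = fv c"
| "fv_sform (Conj \<phi> \<psi>) = fv_sform \<phi> \<union> fv_sform \<psi>"
| "fv_sform (Disj \<phi> \<psi>) = fv_sform \<phi> \<union> fv_sform \<psi>"
| "fv_sform (A \<alpha>) = fv_pform \<alpha>"
| "fv_sform (E \<alpha>) = fv_pform \<alpha>"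
| "fv_pform (X \<phi>) = fv_sform \<phi>"
| "fv_pform (G \<phi>) = fv_sform \<phi>"
| "fv_pform (U \<phi> \<psi>) = fv_sform \<phi> \<union> fv_sform \<psi>"

text \<open>
  The set argument holds the variables in scope. The same variable may be bound in two
  disjoint subformulas, and quantifiers inside assertions are unrestricted.
\<close>

primrec no_shadow :: "('f, 'p, 'x) sform \<Rightarrow> 'x set \<Rightarrow> bool"
  and no_shadow_path :: "('f, 'p, 'x) pform \<Rightarrow> 'x set \<Rightarrow> bool" where
  "no_shadow (Forall x \<phi>) V \<longleftrightarrow> x \<notin> V \<and> no_shadow \<phi> (insert x V)"
| "no_shadow (Exists x \<phi>) V \<longleftrightarrow> x \<notin> V \<and> no_shadow \<phi> (insert x V)"
| "no_shadow (Assn c) V \<longleftrightarrow> True"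
| "no_shadow (Conj \<phi> \<psi>) V \<longleftrightarrow> no_shadow \<phi> V \<and> no_shadow \<psi> V"
| "no_shadow (Disj \<phi> \<psi>) V \<longleftrightarrow> no_shadow \<phi> V \<and> no_shadow \<psi> V"
| "no_shadow (A \<alpha>) V \<longleftrightarrow> no_shadow_path \<alpha> V"
| "no_shadow (E \<alpha>) V \<longleftrightarrow> no_shadow_path \<alpha> V"
| "no_shadow_path (X \<phi>) V \<longleftrightarrow> no_shadow \<phi> V"
| "no_shadow_path (G \<phi>) V \<longleftrightarrow> no_shadow \<phi> V"
| "no_shadow_path (U \<phi> \<psi>) V \<longleftrightarrow> no_shadow \<phi> V \<and> no_shadow \<psi> V"

text \<open>
  The environment \<open>e\<close> records the values that have been substituted for quantified variables, so
  that \<open>sat T P \<phi> e s\<close> says that \<open>s\<close> satisfies \<open>\<phi>\<close> with every \<open>x\<close> in the domain of \<open>e\<close> replaced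
  by its value. It takes precedence over the state, as a substitution does.
\<close>

primrec sat ::
  "('f, 'p, 'd) struct \<Rightarrow> ('f, 'p, 'x) program \<Rightarrow> ('f, 'p, 'x) sform \<Rightarrow> ('x \<rightharpoonup> 'd) \<Rightarrow> ('x \<Rightarrow> 'd) \<Rightarrow> bool"
  and sat_path ::
  "('f, 'p, 'd) struct \<Rightarrow> ('f, 'p, 'x) program \<Rightarrow> ('f, 'p, 'x) pform \<Rightarrow> ('x \<rightharpoonup> 'd) \<Rightarrow>
     (nat \<rightharpoonup> ('x \<Rightarrow> 'd)) \<Rightarrow> bool" where
  "sat T P (Forall x \<phi>) e s \<longleftrightarrow> (\<forall>d. sat T P \<phi> (e(x \<mapsto> d)) s)"
| "sat T P (Exists x \<phi>) e s \<longleftrightarrow> (\<exists>d. sat T P \<phi> (e(x \<mapsto> d)) s)"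
| "sat T P (Assn c) e s \<longleftrightarrow> holds T (\<lambda>x. case e x of Some d \<Rightarrow> d | None \<Rightarrow> s x) c"
| "sat T P (Conj \<phi> \<psi>) e s \<longleftrightarrow> sat T P \<phi> e s \<and> sat T P \<psi> e s"
| "sat T P (Disj \<phi> \<psi>) e s \<longleftrightarrow> sat T P \<phi> e s \<or> sat T P \<psi> e s"
| "sat T P (A \<alpha>) e s \<longleftrightarrow> (\<forall>\<pi>\<in>paths T P s. sat_path T P \<alpha> e \<pi>)"
| "sat T P (E \<alpha>) e s \<longleftrightarrow> (\<exists>\<pi>\<in>paths T P s. sat_path T P \<alpha> e \<pi>)"
| "sat_path T P (X \<phi>) e \<pi> \<longleftrightarrow> (\<exists>t. \<pi> 1 = Some t \<and> sat T P \<phi> e t)"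
| "sat_path T P (G \<phi>) e \<pi> \<longleftrightarrow> (\<forall>i t. \<pi> i = Some t \<longrightarrow> sat T P \<phi> e t)"
| "sat_path T P (U \<phi> \<psi>) e \<pi> \<longleftrightarrow>
     (\<exists>j t. \<pi> j = Some t \<and> sat T P \<psi> e t \<and>
        (\<forall>i<j. \<forall>r. \<pi> i = Some r \<longrightarrow> sat T P \<phi> e r))"

definition models ::
  "('f, 'p, 'd) struct \<Rightarrow> ('f, 'p, 'x) program \<Rightarrow> ('f, 'p, 'x) sform \<Rightarrow> bool" where
  "models T P \<phi> \<longleftrightarrow> (\<forall>s. initial T P s \<longrightarrow> sat T P \<phi> Map.empty s)"


section \<open>Constraints\<close>

text \<open>
  A query symbol is a number together with its arity. Constraints are built from formulas whose
  predicate symbols are either those of the theory (\<^const>\<open>Inl\<close>) or query symbols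
  (\<^const>\<open>Inr\<close>).
\<close>

datatype qsym = QSym (qid: nat) (arity: nat)

type_synonym ('f, 'p, 'x) cfm = "('f, 'p + qsym, 'x pvar) fm"

datatype ('f, 'p, 'x) constraint =
    Imp "('f, 'p, 'x) cfm" "('f, 'p, 'x) cfm"
  | Wf qsym

definition expand ::
  "('f, 'p, 'd) struct \<Rightarrow> (qsym \<Rightarrow> 'd list set) \<Rightarrow> ('f, 'p + qsym, 'd) struct" where
  "expand T Q =
     \<lparr>fn_int = fn_int T, pred_int = case_sum (pred_int T) (\<lambda>q ds. ds \<in> Q q)\<rparr>"

text \<open>
  The symbol in a \<^const>\<open>Wf\<close> constraint has even arity \<open>2 * n\<close> and is read as a binary relation
  on \<open>n\<close>-tuples.
\<close>

primrec sat_constraint ::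
  "('f, 'p, 'd) struct \<Rightarrow> (qsym \<Rightarrow> 'd list set) \<Rightarrow> ('f, 'p, 'x) constraint \<Rightarrow> bool" where
  "sat_constraint T Q (Imp a b) \<longleftrightarrow>
     (\<forall>\<sigma>. holds (expand T Q) \<sigma> a \<longrightarrow> holds (expand T Q) \<sigma> b)"
| "sat_constraint T Q (Wf rank) \<longleftrightarrow>
     \<not> (\<exists>u :: nat \<Rightarrow> 'd list.
          \<forall>i. length (u i) = arity rank div 2 \<and> u i @ u (Suc i) \<in> Q rank)"

definition satisfiable ::
  "('f, 'p, 'd) struct \<Rightarrow> ('f, 'p, 'x) constraint list \<Rightarrow> bool" where
  "satisfiable T cs \<longleftrightarrow>
     (\<exists>Q. (\<forall>q. \<forall>ds\<in>Q q. length ds = arity q) \<and> (\<forall>c\<in>set cs. sat_constraint T Q c))"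


section \<open>Constraint generation\<close>

abbreviation q0 :: "qsym \<Rightarrow> 'x list \<Rightarrow> ('f, 'p, 'x) cfm" where
  "q0 q v \<equiv> PredF (Inr q) (map (Var \<circ> Unprimed) v)"

abbreviation q1 :: "qsym \<Rightarrow> 'x list \<Rightarrow> ('f, 'p, 'x) cfm" where
  "q1 q v \<equiv> PredF (Inr q) (map (Var \<circ> Primed) v)"

abbreviation q01 :: "qsym \<Rightarrow> 'x list \<Rightarrow> ('f, 'p, 'x) cfm" where
  "q01 q v \<equiv> PredF (Inr q) (map (Var \<circ> Unprimed) v @ map (Var \<circ> Primed) v)"

abbreviation Ex_primed :: "'x list \<Rightarrow> ('f, 'p, 'x) cfm \<Rightarrow> ('f, 'p, 'x) cfm" where
  "Ex_primed v a \<equiv> foldr ExF (map Primed v) a"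

abbreviation frozen :: "'x \<Rightarrow> ('f, 'p, 'x) cfm" where
  "frozen x \<equiv> EqF (Var (Primed x)) (Var (Unprimed x))"

text \<open>
  The last argument and the second result of \<open>gen\<close> are the least identifier of an unused query
  symbol. The formula \<open>E (F \<phi>)\<close> is also an instance of \<open>E (U \<phi>\<^sub>1 \<phi>\<^sub>2)\<close>; it is generated by its own
  rule, whereas \<open>A (F \<phi>)\<close> has none.
\<close>

fun gen ::
  "('f, 'p, 'x) sform \<Rightarrow> 'x list \<Rightarrow> ('f, 'p, 'x) cfm \<Rightarrow> ('f, 'p, 'x) cfm \<Rightarrow> nat \<Rightarrow>
     ('f, 'p, 'x) constraint list \<times> nat" where
  "gen (Forall x \<phi>) v ini nxt k = gen \<phi> (v @ [x]) ini (AndF nxt (frozen x)) k"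
| "gen (Exists x \<phi>) v ini nxt k =
     (let v1 = v @ [x];
          aux = QSym k (length v1);
          (cs, k') = gen \<phi> v1 (q0 aux v1) (AndF nxt (frozen x)) (k + 1)
      in ([Imp ini (ExF (Unprimed x) (q0 aux v1))] @ cs, k'))"
| "gen (Assn c) v ini nxt k = ([Imp ini (map_fm (\<lambda>f. f) Inl Unprimed c)], k)"
| "gen (Conj \<phi>1 \<phi>2) v ini nxt k =
     (let aux1 = QSym k (length v);
          aux2 = QSym (k + 1) (length v);
          (cs1, k1) = gen \<phi>1 v (q0 aux1 v) nxt (k + 2);
          (cs2, k2) = gen \<phi>2 v (q0 aux2 v) nxt k1
      in ([Imp ini (AndF (q0 aux1 v) (q0 aux2 v))] @ cs1 @ cs2, k2))"
| "gen (Disj \<phi>1 \<phi>2) v ini nxt k =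
     (let aux1 = QSym k (length v);
          aux2 = QSym (k + 1) (length v);
          (cs1, k1) = gen \<phi>1 v (q0 aux1 v) nxt (k + 2);
          (cs2, k2) = gen \<phi>2 v (q0 aux2 v) nxt k1
      in ([Imp ini (OrF (q0 aux1 v) (q0 aux2 v))] @ cs1 @ cs2, k2))"
| "gen (A (X \<phi>)) v ini nxt k =
     (let aux = QSym k (length v);
          (cs, k') = gen \<phi> v (q0 aux v) nxt (k + 1)
      in ([Imp ini (Ex_primed v nxt),
           Imp (AndF ini nxt) (q1 aux v)] @ cs, k'))"
| "gen (E (X \<phi>)) v ini nxt k =
     (let aux = QSym k (length v);
          (cs, k') = gen \<phi> v (q0 aux v) nxt (k + 1)
      in ([Imp ini (Ex_primed v (AndF nxt (q1 aux v)))] @ cs, k'))"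
| "gen (A (G \<phi>)) v ini nxt k =
     (let inv = QSym k (length v);
          (cs, k') = gen \<phi> v (q0 inv v) nxt (k + 1)
      in ([Imp ini (q0 inv v),
           Imp (AndF (q0 inv v) nxt) (q1 inv v)] @ cs, k'))"
| "gen (E (G \<phi>)) v ini nxt k =
     (let inv = QSym k (length v);
          (cs, k') = gen \<phi> v (q0 inv v) nxt (k + 1)
      in ([Imp ini (q0 inv v),
           Imp (AndF (q0 inv v) nxt) (Ex_primed v (AndF nxt (q1 inv v)))] @ cs, k'))"
| "gen (A (U \<phi>1 \<phi>2)) v ini nxt k =
     (let inv = QSym k (length v);
          aux1 = QSym (k + 1) (length v);
          aux2 = QSym (k + 2) (length v);
          rank = QSym (k + 3) (2 * length v);
          (cs1, k1) = gen \<phi>1 v (q0 aux1 v) nxt (k + 4);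
          (cs2, k2) = gen \<phi>2 v (q0 aux2 v) nxt k1
      in ([Imp ini (q0 inv v),
           Imp (AndF (q0 inv v) (NotF (q0 aux2 v))) (AndF (q0 aux1 v) (Ex_primed v nxt)),
           Imp (AndF (AndF (q0 inv v) (NotF (q0 aux2 v))) nxt) (AndF (q1 inv v) (q01 rank v)),
           Wf rank] @ cs1 @ cs2, k2))"
| "gen (E (U \<phi>1 \<phi>2)) v ini nxt k =
     (if \<phi>1 = Assn TrueF then
        (let inv = QSym k (length v);
             aux = QSym (k + 1) (length v);
             rank = QSym (k + 2) (2 * length v);
             (cs, k') = gen \<phi>2 v (q0 aux v) nxt (k + 3)
         in ([Imp ini (q0 inv v),
              Imp (AndF (q0 inv v) (NotF (q0 aux v)))
                  (Ex_primed v (AndF nxt (AndF (q1 inv v) (q01 rank v)))),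
              Wf rank] @ cs, k'))
      else
        (let inv = QSym k (length v);
             aux1 = QSym (k + 1) (length v);
             aux2 = QSym (k + 2) (length v);
             rank = QSym (k + 3) (2 * length v);
             (cs1, k1) = gen \<phi>1 v (q0 aux1 v) nxt (k + 4);
             (cs2, k2) = gen \<phi>2 v (q0 aux2 v) nxt k1
         in ([Imp ini (q0 inv v),
              Imp (AndF (q0 inv v) (NotF (q0 aux2 v)))
                  (AndF (q0 aux1 v) (Ex_primed v (AndF nxt (AndF (q1 inv v) (q01 rank v))))),
              Wf rank] @ cs1 @ cs2, k2)))"

definition Gen ::
  "('f, 'p, 'x) sform \<Rightarrow> 'x list \<Rightarrow> ('f, 'p, 'x) fm \<Rightarrow> ('f, 'p, 'x pvar) fm \<Rightarrow>
     ('f, 'p, 'x) constraint list" where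
  "Gen \<phi> v ini nxt =
     fst (gen \<phi> v (map_fm (\<lambda>f. f) Inl Unprimed ini) (map_fm (\<lambda>f. f) Inl (\<lambda>y. y) nxt) 0)"

end

theory Submission
  imports Defs
begin

text \<open>
  A state together with values for the quantified variables in scope is a valuation of the tuple
  \<open>v\<^sub>0\<close>, and \<open>next(v\<^sub>0, v\<^sub>0')\<close> is the program step that keeps the quantified variables fixed. Since
  maximality of a path is a local condition, every temporal operator is a fixed point over this
  relation, and each rule of \<open>gen\<close> asks for a witness of the corresponding (co)induction:
  invariants prove \<open>G\<close> coinductively, and well-founded ranks prove \<open>U\<close> inductively. Conversely, if
  the formula holds, let every auxiliary symbol denote the valuations satisfying the subformula
  it stands for. The rank of \<open>A (U \<phi> \<psi>)\<close> is then the step relation between valuations where \<open>\<psi>\<close>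
  is still pending, and the rank of \<open>E (U \<phi> \<psi>)\<close> is the decrease of the distance to \<open>\<psi>\<close>.
\<close>

text \<open>Both directions are inductions on \<phi> for an arbitrary initial condition, since the
  recursive calls of \<open>gen\<close> replace the initial condition by an atom over a query
  symbol. A satisfying interpretation is only known to make such a symbol imply its subformula, not
  to be equivalent to it. This suffices because the rules negate a symbol only to the left of an
  implication, where failure of the subformula yields the negation. Dead ends shape the rules as
  well: \<open>A (X \<phi>)\<close>, and \<open>A (U \<phi> \<psi>)\<close> while \<psi> is pending,
  require a successor to exist, whereas \<open>E (G \<phi>)\<close> asks for an invariant successor
  only where there is some successor, because a maximal path may be finite. Finally, formulas are
  evaluated under total valuations, states are fixed outside the program variables, and a query
  symbol sees only a tuple of values; so each predicate that interprets a symbol must be shown to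
  depend on that tuple alone. Absence of shadowing keeps quantified variables apart from program
  variables, so that the state can change while the environment stays.\<close>

section \<open>Assertions under renaming and change of valuation\<close>

lemma eval_expand_map:
  "eval (expand T Q) \<sigma> (map_trm (\<lambda>f. f) g t) = eval T (\<sigma> \<circ> g) t"
  by (induction t) (auto simp: expand_def cong: map_cong)

text \<open>Injectivity matters at the quantifiers: updating a valuation at \<open>g x\<close> must
  change the renamed valuation at \<open>x\<close> and nowhere else. A renaming that merges
  variables would capture.\<close>

lemma holds_expand_map:
  assumes "inj g"
  shows "holds (expand T Q) \<sigma> (map_fm (\<lambda>f. f) Inl g c) \<longleftrightarrow> holds T (\<sigma> \<circ> g) c"
proof (induction c arbitrary: \<sigma>)
  case (PredF p ts)
  have "eval (expand T Q) \<sigma> \<circ> map_trm (\<lambda>f. f) g = eval T (\<sigma> \<circ> g)"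
    by (simp add: eval_expand_map fun_eq_iff)
  moreover have "pred_int (expand T Q) (Inl p) = pred_int T p" by (simp add: expand_def)
  ultimately show ?case by (simp del: comp_apply)
next
  case (AllF x c)
  have "\<sigma>(g x := d) \<circ> g = (\<sigma> \<circ> g)(x := d)" for d
    using assms by (auto simp: fun_eq_iff inj_eq)
  with AllF show ?case by (simp only: fm.map holds.simps)
next
  case (ExF x c)
  have "\<sigma>(g x := d) \<circ> g = (\<sigma> \<circ> g)(x := d)" for d
    using assms by (auto simp: fun_eq_iff inj_eq)
  with ExF show ?case by (simp only: fm.map holds.simps)
qed (simp_all add: eval_expand_map)

lemma eval_cong: "(\<And>x. x \<in> vars_trm t \<Longrightarrow> \<sigma> x = \<tau> x) \<Longrightarrow> eval T \<sigma> t = eval T \<tau> t"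
proof (induction t)
  case (Fn f ts)
  then have "map (eval T \<sigma>) ts = map (eval T \<tau>) ts" by (auto intro!: Fn.IH)
  then show ?case by (simp only: eval.simps)
qed simp

lemma holds_cong: "(\<And>x. x \<in> fv c \<Longrightarrow> \<sigma> x = \<tau> x) \<Longrightarrow> holds T \<sigma> c \<longleftrightarrow> holds T \<tau> c"
proof (induction c arbitrary: \<sigma> \<tau>)
  case (EqF s t)
  then have "eval T \<sigma> s = eval T \<tau> s" "eval T \<sigma> t = eval T \<tau> t" by (auto intro!: eval_cong)
  then show ?case by simp
next
  case (PredF p ts)
  then have "map (eval T \<sigma>) ts = map (eval T \<tau>) ts" by (auto intro!: eval_cong)
  then show ?case by (simp only: holds.simps)
next
  case (NotF c)
  then show ?case by (metis fv.simps(4) holds.simps(4))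
next
  case (AndF c d)
  have "holds T \<sigma> c = holds T \<tau> c" "holds T \<sigma> d = holds T \<tau> d"
    using AndF.prems by (auto intro!: AndF.IH)
  then show ?case by simp
next
  case (OrF c d)
  have "holds T \<sigma> c = holds T \<tau> c" "holds T \<sigma> d = holds T \<tau> d"
    using OrF.prems by (auto intro!: OrF.IH)
  then show ?case by simp
next
  case (AllF x c)
  have "holds T (\<sigma>(x := d)) c = holds T (\<tau>(x := d)) c" for d
    using AllF.prems by (auto intro!: AllF.IH)
  then show ?case by simp
next
  case (ExF x c)
  have "holds T (\<sigma>(x := d)) c = holds T (\<tau>(x := d)) c" for d
    using ExF.prems by (auto intro!: ExF.IH)
  then show ?case by simp
qed simp

section \<open>Maximal paths\<close>

text \<open>An execution that stops at a state with a successor can be prolonged by one element.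
  Conversely, an extension can first differ from \<pi> only at an index where \<pi> has ended, and
  there it exhibits a step out of the last state of \<pi>.\<close>

lemma paths_iff:
  "\<pi> \<in> paths T P s \<longleftrightarrow>
     execution T P s \<pi> \<and> (\<forall>i t t'. \<pi> i = Some t \<and> step T P t t' \<longrightarrow> \<pi> (Suc i) \<noteq> None)"
proof (intro iffI conjI allI impI notI)
  assume path: "\<pi> \<in> paths T P s"
  then show ex: "execution T P s \<pi>" by (simp add: paths_def)
  fix i t t'
  assume i: "\<pi> i = Some t \<and> step T P t t'" and none: "\<pi> (Suc i) = None"
  define \<rho> where "\<rho> = \<pi>(Suc i \<mapsto> t')"
  have "execution T P s \<rho>"
    using ex i none unfolding execution_def \<rho>_def by (auto split: if_splits) fastforce
  moreover have "\<pi> \<subseteq>\<^sub>m \<rho>" using none by (auto simp: \<rho>_def map_le_def)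
  ultimately have "\<rho> = \<pi>" using path by (auto simp: paths_def)
  then have "\<rho> (Suc i) = \<pi> (Suc i)" by (rule fun_cong)
  then show False using none by (simp add: \<rho>_def)
next
  assume \<section>: "execution T P s \<pi> \<and> (\<forall>i t t'. \<pi> i = Some t \<and> step T P t t' \<longrightarrow> \<pi> (Suc i) \<noteq> None)"
  have "\<rho> = \<pi>" if \<rho>: "execution T P s \<rho>" "\<pi> \<subseteq>\<^sub>m \<rho>" for \<rho>
  proof
    fix i
    show "\<rho> i = \<pi> i"
    proof (induction i)
      case 0
      then show ?case using \<section> \<rho> by (simp add: execution_def)
    next
      case (Suc i)
      show ?case
      proof (cases "\<pi> (Suc i)")
        case None
        \<comment> \<open>If \<rho> went on here, the two sequences would agree at \<open>i\<close>
          and \<rho> would supply a step from that state, so \<pi> could not have ended.\<close>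
        then show ?thesis using Suc \<section> \<rho>(1) unfolding execution_def
          by (metis option.exhaust)
      next
        case (Some t)
        then show ?thesis using \<rho>(2) by (metis domI map_le_def)
      qed
    qed
  qed
  with \<section> show "\<pi> \<in> paths T P s" by (simp add: paths_def)
qed

lemma step_states: "step T P s t \<Longrightarrow> s \<in> states P \<and> t \<in> states P"
  by (simp add: step_def)

lemma paths_0: "\<pi> \<in> paths T P s \<Longrightarrow> \<pi> 0 = Some s"
  by (simp add: paths_iff execution_def)

lemma paths_step:
  "\<pi> \<in> paths T P s \<Longrightarrow> \<pi> i = Some r \<Longrightarrow> \<pi> (Suc i) = Some t \<Longrightarrow> step T P r t"
  by (fastforce simp: paths_iff execution_def)

lemma paths_1: "\<pi> \<in> paths T P s \<Longrightarrow> \<pi> 1 = Some t \<Longrightarrow> step T P s t"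
  using paths_step[of \<pi> T P s 0] by (simp add: paths_0)

lemma paths_down: "\<pi> \<in> paths T P s \<Longrightarrow> \<pi> (Suc i) = Some t \<Longrightarrow> \<exists>r. \<pi> i = Some r \<and> step T P r t"
  by (simp add: paths_iff execution_def)

lemma paths_progress:
  "\<pi> \<in> paths T P s \<Longrightarrow> \<pi> i = Some r \<Longrightarrow> step T P r t \<Longrightarrow> \<exists>t'. \<pi> (Suc i) = Some t'"
  unfolding paths_iff by blast

lemma paths_Cons:
  assumes "step T P s t" and "\<pi> \<in> paths T P t"
  shows "case_nat (Some s) \<pi> \<in> paths T P s"
  using assms unfolding paths_iff execution_def step_def by (auto split: nat.splits)

lemma paths_tl:
  assumes "\<pi> \<in> paths T P s" and "\<pi> 1 = Some t"
  shows "(\<lambda>i. \<pi> (Suc i)) \<in> paths T P t"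
  using assms paths_1[OF assms] unfolding paths_iff execution_def by (auto dest: step_states)

text \<open>A sequence defined at every index leaves no room for an extension, so an infinite chain
  of steps is a path without any further argument.\<close>

lemma paths_chain:
  assumes "\<And>i. step T P (u i) (u (Suc i))"
  shows "(\<lambda>i. Some (u i)) \<in> paths T P (u 0)"
  using assms unfolding paths_iff execution_def by (auto dest: step_states)

text \<open>The path is built greedily: as long as a successor exists, one that keeps
  \<open>I\<close> is chosen, and otherwise the path ends. It is maximal because it ends only in
  dead ends.\<close>

lemma paths_invariant:
  assumes "s \<in> states P" and "I s"
    and *: "\<And>t t'. I t \<Longrightarrow> step T P t t' \<Longrightarrow> \<exists>t'. step T P t t' \<and> I t'"
  shows "\<exists>\<pi>\<in>paths T P s. \<forall>i t. \<pi> i = Some t \<longrightarrow> I t"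
proof -
  define h where "h t = (SOME t'. step T P t t' \<and> I t')" for t
  have h: "step T P t (h t) \<and> I (h t)" if "I t" "step T P t t'" for t t'
    unfolding h_def using *[OF that] by (rule someI_ex)
  \<comment> \<open>\<open>None\<close> is absorbing, which makes the domain downward
    closed.\<close>
  define \<pi> where "\<pi> = rec_nat (Some s)
    (\<lambda>_ r. case r of None \<Rightarrow> None | Some t \<Rightarrow> if \<exists>t'. step T P t t' then Some (h t) else None)"
  have \<pi>0: "\<pi> 0 = Some s"
    and \<pi>Suc: "\<pi> (Suc i) = (case \<pi> i of None \<Rightarrow> None
      | Some t \<Rightarrow> if \<exists>t'. step T P t t' then Some (h t) else None)" for i
    by (simp_all add: \<pi>_def)
  have I: "\<pi> i = Some t \<longrightarrow> I t" for i t
  proof (induction i arbitrary: t)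
    case (Suc i)
    then show ?case using h by (auto simp: \<pi>Suc split: option.splits if_splits)
  qed (use \<open>I s\<close> in \<open>auto simp: \<pi>0\<close>)
  have "\<pi> \<in> paths T P s"
    unfolding paths_iff execution_def using assms(1) I h
    by (auto simp: \<pi>0 \<pi>Suc split: option.splits if_splits)
  with I show ?thesis by blast
qed

text \<open>The trivial invariant turns the greedy construction into an existence proof for maximal
  paths.\<close>

lemma paths_nonempty: "s \<in> states P \<Longrightarrow> \<exists>\<pi>. \<pi> \<in> paths T P s"
  using paths_invariant[of s P "\<lambda>_. True" T] by blast

section \<open>Fixed point characterisations of the temporal operators\<close>

text \<open>\<open>X\<close> demands a second state, so \<open>A (X \<phi>)\<close> fails in a dead
  end, where the only path consists of \<open>s\<close>; hence the first conjunct. The second holds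
  because every successor lies on some maximal path from \<open>s\<close>.\<close>

lemma sat_AX:
  assumes "s \<in> states P"
  shows "sat T P (A (X \<phi>)) e s \<longleftrightarrow>
    (\<exists>t. step T P s t) \<and> (\<forall>t. step T P s t \<longrightarrow> sat T P \<phi> e t)"
proof (intro iffI conjI allI impI)
  assume \<section>: "sat T P (A (X \<phi>)) e s"
  obtain \<pi> where \<pi>: "\<pi> \<in> paths T P s" using paths_nonempty[OF assms] by blast
  with \<section> obtain t where "\<pi> 1 = Some t" by auto
  with \<pi> show "\<exists>t. step T P s t" by (blast dest: paths_1)
  fix t assume t: "step T P s t"
  then obtain \<rho> where \<rho>: "\<rho> \<in> paths T P t" using step_states paths_nonempty by metis
  from \<section> paths_Cons[OF t \<rho>] paths_0[OF \<rho>] show "sat T P \<phi> e t" by fastforce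
next
  assume \<section>: "(\<exists>t. step T P s t) \<and> (\<forall>t. step T P s t \<longrightarrow> sat T P \<phi> e t)"
  have "sat_path T P (X \<phi>) e \<pi>" if \<pi>: "\<pi> \<in> paths T P s" for \<pi>
  proof -
    from \<section> obtain t' where "step T P s t'" by blast
    with paths_progress[OF \<pi> paths_0[OF \<pi>]] obtain t where t: "\<pi> 1 = Some t" by auto
    with paths_1[OF \<pi> t] \<section> show ?thesis by auto
  qed
  then show "sat T P (A (X \<phi>)) e s" by simp
qed

lemma sat_EX: "sat T P (E (X \<phi>)) e s \<longleftrightarrow> (\<exists>t. step T P s t \<and> sat T P \<phi> e t)"
proof
  assume "sat T P (E (X \<phi>)) e s"
  then show "\<exists>t. step T P s t \<and> sat T P \<phi> e t" by (auto dest: paths_1)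
next
  assume "\<exists>t. step T P s t \<and> sat T P \<phi> e t"
  then obtain t where t: "step T P s t" "sat T P \<phi> e t" by blast
  then obtain \<rho> where \<rho>: "\<rho> \<in> paths T P t" using step_states paths_nonempty by metis
  have "sat_path T P (X \<phi>) e (case_nat (Some s) \<rho>)" using paths_0[OF \<rho>] t(2) by simp
  with paths_Cons[OF t(1) \<rho>] show "sat T P (E (X \<phi>)) e s" unfolding sat.simps by blast
qed

lemma sat_AG_coinduct:
  assumes "I s"
    and "\<And>t. I t \<Longrightarrow> sat T P \<phi> e t"
    and "\<And>t t'. I t \<Longrightarrow> step T P t t' \<Longrightarrow> I t'"
  shows "sat T P (A (G \<phi>)) e s"
proof -
  have "I t" if "\<pi> \<in> paths T P s" "\<pi> i = Some t" for \<pi> i t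
    using that(2)
  proof (induction i arbitrary: t)
    case 0
    then show ?case using assms(1) paths_0[OF that(1)] by simp
  next
    case (Suc i)
    then show ?case using paths_down[OF that(1)] assms(3) by blast
  qed
  with assms(2) show ?thesis by auto
qed

lemma sat_AG_unfold:
  assumes "s \<in> states P" and "sat T P (A (G \<phi>)) e s"
  shows "sat T P \<phi> e s" and "step T P s t \<Longrightarrow> sat T P (A (G \<phi>)) e t"
proof -
  obtain \<pi> where \<pi>: "\<pi> \<in> paths T P s" using paths_nonempty[OF assms(1)] by blast
  with assms(2) paths_0[OF \<pi>] show "sat T P \<phi> e s" by auto
  assume t: "step T P s t"
  have "sat_path T P (G \<phi>) e \<rho>" if "\<rho> \<in> paths T P t" for \<rho>
  proof -
    have "sat_path T P (G \<phi>) e (case_nat (Some s) \<rho>)"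
      using assms(2) paths_Cons[OF t that] by simp
    then show ?thesis by (metis sat_path.simps(2) old.nat.simps(5))
  qed
  then show "sat T P (A (G \<phi>)) e t" by simp
qed

text \<open>The last premise is conditional on some step being possible: a path that ends in a dead
  end satisfies \<open>G\<close> if all its finitely many states do.\<close>

lemma sat_EG_coinduct:
  assumes "s \<in> states P" and "I s"
    and "\<And>t. I t \<Longrightarrow> sat T P \<phi> e t"
    and "\<And>t t'. I t \<Longrightarrow> step T P t t' \<Longrightarrow> \<exists>t'. step T P t t' \<and> I t'"
  shows "sat T P (E (G \<phi>)) e s"
proof -
  obtain \<pi> where "\<pi> \<in> paths T P s" "\<forall>i t. \<pi> i = Some t \<longrightarrow> I t"
    using paths_invariant[of s P I T] assms(1,2,4) by blast
  with assms(3) show ?thesis by auto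
qed

lemma sat_EG_unfold:
  assumes "sat T P (E (G \<phi>)) e s"
  shows "sat T P \<phi> e s"
    and "step T P s t' \<Longrightarrow> \<exists>t. step T P s t \<and> sat T P (E (G \<phi>)) e t"
proof -
  from assms obtain \<pi> where \<pi>: "\<pi> \<in> paths T P s" and G: "\<forall>i t. \<pi> i = Some t \<longrightarrow> sat T P \<phi> e t"
    by auto
  from G paths_0[OF \<pi>] show "sat T P \<phi> e s" by blast
  assume "step T P s t'"
  with paths_progress[OF \<pi> paths_0[OF \<pi>]] obtain t where t: "\<pi> 1 = Some t" by auto
  have "sat_path T P (G \<phi>) e (\<lambda>i. \<pi> (Suc i))" using G by simp
  with paths_tl[OF \<pi> t] have "sat T P (E (G \<phi>)) e t" unfolding sat.simps by blast
  with paths_1[OF \<pi> t] show "\<exists>t. step T P s t \<and> sat T P (E (G \<phi>)) e t" by blast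
qed

text \<open>As long as \<psi> is pending, \<open>I\<close> persists and a successor exists, so a
  maximal path cannot end. A path that avoided \<psi> altogether would be infinite and form the
  excluded chain.\<close>

lemma sat_AU_induct:
  assumes "I s"
    and progress: "\<And>t. I t \<Longrightarrow> \<not> sat T P \<psi> e t \<Longrightarrow> sat T P \<phi> e t \<and> (\<exists>t'. step T P t t')"
    and preserve: "\<And>t t'. I t \<Longrightarrow> \<not> sat T P \<psi> e t \<Longrightarrow> step T P t t' \<Longrightarrow> I t'"
    and chain: "\<not> (\<exists>u. u 0 = s \<and> (\<forall>i. I (u i) \<and> \<not> sat T P \<psi> e (u i) \<and> step T P (u i) (u (Suc i))))"
  shows "sat T P (A (U \<phi> \<psi>)) e s"
proof -
  have "sat_path T P (U \<phi> \<psi>) e \<pi>" if \<pi>: "\<pi> \<in> paths T P s" for \<pi>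
  proof -
    have I: "\<exists>t. \<pi> i = Some t \<and> I t" if "\<And>j t. j < i \<Longrightarrow> \<pi> j = Some t \<Longrightarrow> \<not> sat T P \<psi> e t" for i
      using that
    proof (induction i)
      case 0
      then show ?case using assms(1) paths_0[OF \<pi>] by simp
    next
      case (Suc i)
      then obtain t where t: "\<pi> i = Some t" "I t" "\<not> sat T P \<psi> e t" by (meson lessI less_Suc_eq)
      with progress obtain t' where "step T P t t'" by blast
      with paths_progress[OF \<pi> t(1)] obtain r where r: "\<pi> (Suc i) = Some r" by auto
      with paths_step[OF \<pi> t(1) r] preserve t show ?case by blast
    qed
    have "\<exists>j t. \<pi> j = Some t \<and> sat T P \<psi> e t"
    proof (rule ccontr)
      assume "\<not> ?thesis"
      then have never: "\<pi> j = Some t \<Longrightarrow> \<not> sat T P \<psi> e t" for j t by blast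
      have all: "\<pi> i = Some (the (\<pi> i)) \<and> I (the (\<pi> i))" for i
        using I[of i] never by fastforce
      have "the (\<pi> 0) = s" using paths_0[OF \<pi>] by simp
      moreover have "step T P (the (\<pi> i)) (the (\<pi> (Suc i)))" for i
        using paths_step[OF \<pi>] all by blast
      ultimately show False
        using chain[unfolded not_ex, rule_format, of "\<lambda>i. the (\<pi> i)"] all never by blast
    qed
    then obtain k where k: "\<exists>t. \<pi> k = Some t \<and> sat T P \<psi> e t" by blast
    \<comment> \<open>The first occurrence of \<psi> is needed, because \<open>progress\<close>
      gives \<phi> only at states where \<psi> is still pending.\<close>
    define j where "j = (LEAST j. \<exists>t. \<pi> j = Some t \<and> sat T P \<psi> e t)"
    have j: "\<exists>t. \<pi> j = Some t \<and> sat T P \<psi> e t"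
      unfolding j_def using k by (rule LeastI)
    have before: "\<not> sat T P \<psi> e t" if "i < j" "\<pi> i = Some t" for i t
      using not_less_Least[of i] that unfolding j_def by blast
    have "sat T P \<phi> e r" if "i < j" "\<pi> i = Some r" for i r
      using I[of i] before that progress by (metis less_trans option.inject)
    with j show ?thesis by auto
  qed
  then show ?thesis by simp
qed

lemma sat_AU_unfold:
  assumes "s \<in> states P" and "sat T P (A (U \<phi> \<psi>)) e s" and "\<not> sat T P \<psi> e s"
  shows "sat T P \<phi> e s" and "\<exists>t. step T P s t" and "step T P s t \<Longrightarrow> sat T P (A (U \<phi> \<psi>)) e t"
proof -
  \<comment> \<open>Since \<psi> fails at \<open>s\<close>, the index that \<open>U\<close> provides
    is positive on every path; this gives \<phi> at \<open>s\<close>, a second state, and the same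
    property for the tail.\<close>
  have U: "\<exists>j t. \<pi> (Suc j) = Some t \<and> sat T P \<psi> e t \<and>
      (\<forall>i<Suc j. \<forall>r. \<pi> i = Some r \<longrightarrow> sat T P \<phi> e r)" if \<pi>: "\<pi> \<in> paths T P s" for \<pi>
  proof -
    from assms(2) \<pi> obtain j t where "\<pi> j = Some t" "sat T P \<psi> e t"
      "\<forall>i<j. \<forall>r. \<pi> i = Some r \<longrightarrow> sat T P \<phi> e r" by auto
    moreover from this assms(3) paths_0[OF \<pi>] have "j \<noteq> 0" by (cases j) auto
    ultimately show ?thesis by (metis not0_implies_Suc)
  qed
  obtain \<pi> where \<pi>: "\<pi> \<in> paths T P s" using paths_nonempty[OF assms(1)] by blast
  from U[OF \<pi>] paths_0[OF \<pi>] show "sat T P \<phi> e s" by blast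
  have "\<pi> (Suc j) = Some t \<Longrightarrow> \<exists>t. \<pi> 1 = Some t" for j t
    by (induction j arbitrary: t) (auto dest: paths_down[OF \<pi>])
  with U[OF \<pi>] paths_1[OF \<pi>] show "\<exists>t. step T P s t" by blast
  assume t: "step T P s t"
  have "sat_path T P (U \<phi> \<psi>) e \<rho>" if "\<rho> \<in> paths T P t" for \<rho>
    using U[OF paths_Cons[OF t that]] by fastforce
  then show "sat T P (A (U \<phi> \<psi>)) e t" by simp
qed

text \<open>The chain would itself be a maximal path from \<open>u 0\<close> on which \<psi> never
  holds.\<close>

lemma sat_AU_no_chain:
  "\<not> (\<forall>i. sat T P (A (U \<phi> \<psi>)) e (u i) \<and> \<not> sat T P \<psi> e (u i) \<and> step T P (u i) (u (Suc i)))"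
proof
  assume \<section>: "\<forall>i. sat T P (A (U \<phi> \<psi>)) e (u i) \<and> \<not> sat T P \<psi> e (u i) \<and> step T P (u i) (u (Suc i))"
  then have "sat_path T P (U \<phi> \<psi>) e (\<lambda>i. Some (u i))"
    using paths_chain[of T P u] by (metis sat.simps(6))
  with \<section> show False by auto
qed

section \<open>Existential until and the distance to its goal\<close>

text \<open>Index \<open>n\<close> need not be the first one at which \<psi> holds. This keeps the
  recursion in \<open>n\<close> exact; minimality enters only through the distance.\<close>

definition until_at where
  "until_at T P \<phi> \<psi> e n s \<longleftrightarrow> (\<exists>\<pi>\<in>paths T P s. \<exists>t. \<pi> n = Some t \<and> sat T P \<psi> e t \<and>
     (\<forall>i<n. \<forall>r. \<pi> i = Some r \<longrightarrow> sat T P \<phi> e r))"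

lemma sat_EU_iff: "sat T P (E (U \<phi> \<psi>)) e s \<longleftrightarrow> (\<exists>n. until_at T P \<phi> \<psi> e n s)"
  by (auto simp: until_at_def)

lemma until_at_0:
  assumes "s \<in> states P"
  shows "until_at T P \<phi> \<psi> e 0 s \<longleftrightarrow> sat T P \<psi> e s"
proof -
  obtain \<pi> where \<pi>: "\<pi> \<in> paths T P s" using paths_nonempty[OF assms] by blast
  show ?thesis
  proof
    assume "until_at T P \<phi> \<psi> e 0 s"
    then show "sat T P \<psi> e s" by (auto simp: until_at_def dest: paths_0)
  next
    assume "sat T P \<psi> e s"
    with \<pi> paths_0[OF \<pi>] show "until_at T P \<phi> \<psi> e 0 s" by (auto simp: until_at_def)
  qed
qed

lemma until_at_Suc:
  "until_at T P \<phi> \<psi> e (Suc n) s \<longleftrightarrow>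
     sat T P \<phi> e s \<and> (\<exists>t. step T P s t \<and> until_at T P \<phi> \<psi> e n t)"
proof
  assume "until_at T P \<phi> \<psi> e (Suc n) s"
  then obtain \<pi> t where \<pi>: "\<pi> \<in> paths T P s" and t: "\<pi> (Suc n) = Some t" "sat T P \<psi> e t"
    and \<phi>: "\<forall>i<Suc n. \<forall>r. \<pi> i = Some r \<longrightarrow> sat T P \<phi> e r" by (auto simp: until_at_def)
  have "\<pi> (Suc j) = Some t \<Longrightarrow> \<exists>t. \<pi> 1 = Some t" for j t
    by (induction j arbitrary: t) (auto dest: paths_down[OF \<pi>])
  with t obtain r where r: "\<pi> 1 = Some r" by blast
  have "until_at T P \<phi> \<psi> e n r" unfolding until_at_def
    using paths_tl[OF \<pi> r] t \<phi> by (intro bexI[of _ "\<lambda>i. \<pi> (Suc i)"]) auto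
  with paths_1[OF \<pi> r] \<phi> paths_0[OF \<pi>]
  show "sat T P \<phi> e s \<and> (\<exists>t. step T P s t \<and> until_at T P \<phi> \<psi> e n t)" by blast
next
  assume "sat T P \<phi> e s \<and> (\<exists>t. step T P s t \<and> until_at T P \<phi> \<psi> e n t)"
  then obtain t \<rho> where t: "step T P s t" and \<rho>: "\<rho> \<in> paths T P t" and \<phi>: "sat T P \<phi> e s"
    and U: "\<exists>t. \<rho> n = Some t \<and> sat T P \<psi> e t \<and> (\<forall>i<n. \<forall>r. \<rho> i = Some r \<longrightarrow> sat T P \<phi> e r)"
    by (auto simp: until_at_def)
  show "until_at T P \<phi> \<psi> e (Suc n) s" unfolding until_at_def
    using paths_Cons[OF t \<rho>] U \<phi> by (intro bexI[of _ "case_nat (Some s) \<rho>"]) (auto split: nat.splits)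
qed

text \<open>Where \<psi> cannot be reached in the required way the value is unspecified, but still a
  natural number, so comparing distances is well-founded on all states.\<close>

definition until_dist where
  "until_dist T P \<phi> \<psi> e s = (LEAST n. until_at T P \<phi> \<psi> e n s)"

text \<open>As \<psi> fails at \<open>s\<close>, the distance is positive, and the first step of a
  shortest witness leads to a state from which one step fewer suffices.\<close>

lemma sat_EU_unfold:
  assumes "s \<in> states P" and "sat T P (E (U \<phi> \<psi>)) e s" and "\<not> sat T P \<psi> e s"
  shows "sat T P \<phi> e s \<and> (\<exists>t. step T P s t \<and> sat T P (E (U \<phi> \<psi>)) e t \<and>
    until_dist T P \<phi> \<psi> e t < until_dist T P \<phi> \<psi> e s)"
proof -
  have n: "until_at T P \<phi> \<psi> e (until_dist T P \<phi> \<psi> e s) s"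
    unfolding until_dist_def using assms(2) unfolding sat_EU_iff by (rule LeastI_ex)
  with assms until_at_0 obtain m where m: "until_dist T P \<phi> \<psi> e s = Suc m"
    by (metis old.nat.exhaust)
  with n obtain t where t: "sat T P \<phi> e s" "step T P s t" "until_at T P \<phi> \<psi> e m t"
    by (auto simp: until_at_Suc)
  then have "until_dist T P \<phi> \<psi> e t \<le> m" unfolding until_dist_def by (blast intro: Least_le)
  with t m show ?thesis unfolding sat_EU_iff by (metis le_imp_less_Suc)
qed

lemma sat_EU_intro:
  assumes "s \<in> states P"
    and "sat T P \<psi> e s \<or> sat T P \<phi> e s \<and> (\<exists>t. step T P s t \<and> sat T P (E (U \<phi> \<psi>)) e t)"
  shows "sat T P (E (U \<phi> \<psi>)) e s"
  using assms unfolding sat_EU_iff by (metis until_at_0 until_at_Suc)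

section \<open>States as valuations of the variables in scope\<close>

definition state_of :: "('f, 'p, 'x) program \<Rightarrow> ('x \<Rightarrow> 'd) \<Rightarrow> 'x \<Rightarrow> 'd" where
  "state_of P a = (\<lambda>x. if x \<in> set (pvars P) then a x else undefined)"

definition env_of :: "'x list \<Rightarrow> ('x \<Rightarrow> 'd) \<Rightarrow> 'x \<rightharpoonup> 'd" where
  "env_of xs a = (\<lambda>x. if x \<in> set xs then Some (a x) else None)"

definition vsat where
  "vsat T P \<phi> xs a \<longleftrightarrow> sat T P \<phi> (env_of xs a) (state_of P a)"

text \<open>The second conjunct is the meaning of the formulas \<open>frozen x\<close> that the
  quantifier rules of \<open>gen\<close> accumulate in the transition relation.\<close>

definition vstep where
  "vstep T P xs a b \<longleftrightarrow> step T P (state_of P a) (state_of P b) \<and> env_of xs b = env_of xs a"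

text \<open>The hypotheses of the theorem in the form that survives descent under quantifiers, with
  \<open>xs\<close> the quantified variables passed so far. Disjointness is what absence of
  shadowing contributes.\<close>

definition in_scope where
  "in_scope P xs \<phi> \<longleftrightarrow> set xs \<inter> set (pvars P) = {} \<and>
     fv_sform \<phi> \<subseteq> set (pvars P @ xs) \<and> no_shadow \<phi> (set (pvars P @ xs))"

lemma state_of_states [simp]: "state_of P a \<in> states P"
  by (simp add: state_of_def states_def)

lemma env_of_append [simp]: "env_of (xs @ [x]) a = (env_of xs a)(x \<mapsto> a x)"
  by (auto simp: env_of_def fun_eq_iff)

lemma env_of_upd [simp]: "(env_of xs (a(x := d)))(x \<mapsto> d) = (env_of xs a)(x \<mapsto> d)"
  by (auto simp: env_of_def fun_eq_iff)

lemma state_of_upd [simp]: "x \<notin> set (pvars P) \<Longrightarrow> state_of P (a(x := d)) = state_of P a"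
  by (auto simp: state_of_def fun_eq_iff)

lemma state_of_cong:
  "map a (pvars P @ xs) = map b (pvars P @ xs) \<Longrightarrow> state_of P a = state_of P b"
  by (auto simp: state_of_def fun_eq_iff)

lemma env_of_cong:
  "map a (pvars P @ xs) = map b (pvars P @ xs) \<Longrightarrow> env_of xs a = env_of xs b"
  by (auto simp: env_of_def fun_eq_iff)

lemma vsat_cong:
  "map a (pvars P @ xs) = map b (pvars P @ xs) \<Longrightarrow> vsat T P \<phi> xs a \<longleftrightarrow> vsat T P \<phi> xs b"
  unfolding vsat_def by (metis state_of_cong env_of_cong)

lemma vstep_cong:
  "map a (pvars P @ xs) = map a' (pvars P @ xs) \<Longrightarrow> map b (pvars P @ xs) = map b' (pvars P @ xs) \<Longrightarrow>
     vstep T P xs a b \<longleftrightarrow> vstep T P xs a' b'"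
  unfolding vstep_def by (metis state_of_cong env_of_cong)

lemma vstep_append: "vstep T P (xs @ [x]) a b \<longleftrightarrow> vstep T P xs a b \<and> b x = a x"
  unfolding vstep_def
  by (auto simp: env_of_def fun_eq_iff)

text \<open>Overwriting \<open>a\<close> by \<open>t\<close> on the program variables gives a
  valuation above \<open>t\<close>. By disjointness the quantified variables keep their values, as a
  frozen step demands.\<close>

lemma vstep_ex:
  assumes "set xs \<inter> set (pvars P) = {}" and "step T P (state_of P a) t"
  obtains b where "vstep T P xs a b" and "t = state_of P b" and "env_of xs b = env_of xs a"
proof
  let ?b = "\<lambda>x. if x \<in> set (pvars P) then t x else a x"
  have "t \<in> states P" using assms(2) by (simp add: step_def)
  then show t: "t = state_of P ?b" by (auto simp: state_of_def states_def fun_eq_iff)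
  show e: "env_of xs ?b = env_of xs a" using assms(1) by (auto simp: env_of_def fun_eq_iff)
  show "vstep T P xs a ?b" unfolding vstep_def using assms(2) t e by simp
qed

text \<open>The substituted value moves from the environment into the valuation; as \<open>x\<close>
  is no program variable, the state is unaffected.\<close>

lemma vsat_Forall:
  "x \<notin> set (pvars P) \<Longrightarrow>
     vsat T P (Forall x \<phi>) xs a \<longleftrightarrow> (\<forall>d. vsat T P \<phi> (xs @ [x]) (a(x := d)))"
  by (simp add: vsat_def)

lemma vsat_Exists:
  "x \<notin> set (pvars P) \<Longrightarrow>
     vsat T P (Exists x \<phi>) xs a \<longleftrightarrow> (\<exists>d. vsat T P \<phi> (xs @ [x]) (a(x := d)))"
  by (simp add: vsat_def)

text \<open>On variables in scope, the environment laid over the state gives back \<open>a\<close>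
  itself, and an assertion in scope sees no others.\<close>

lemma vsat_Assn: "fv c \<subseteq> set (pvars P @ xs) \<Longrightarrow> vsat T P (Assn c) xs a \<longleftrightarrow> holds T a c"
  unfolding vsat_def sat.simps
  by (rule holds_cong) (auto simp: env_of_def state_of_def split: option.splits)

lemma vsat_Conj: "vsat T P (Conj \<phi> \<psi>) xs a \<longleftrightarrow> vsat T P \<phi> xs a \<and> vsat T P \<psi> xs a"
  by (simp add: vsat_def)

lemma vsat_Disj: "vsat T P (Disj \<phi> \<psi>) xs a \<longleftrightarrow> vsat T P \<phi> xs a \<or> vsat T P \<psi> xs a"
  by (simp add: vsat_def)

section \<open>Fixed points over valuations\<close>

context
  fixes T :: "('f, 'p, 'd) struct" and P :: "('f, 'p, 'x) program" and xs :: "'x list"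
  assumes disjoint: "set xs \<inter> set (pvars P) = {}"
begin

lemma vsat_AX:
  "vsat T P (A (X \<phi>)) xs a \<longleftrightarrow>
     (\<exists>b. vstep T P xs a b) \<and> (\<forall>b. vstep T P xs a b \<longrightarrow> vsat T P \<phi> xs b)"
proof -
  have "(\<exists>b. vstep T P xs a b) \<longleftrightarrow> (\<exists>t. step T P (state_of P a) t)"
    by (metis vstep_ex[OF disjoint] vstep_def)
  moreover have "(\<forall>b. vstep T P xs a b \<longrightarrow> vsat T P \<phi> xs b) \<longleftrightarrow>
      (\<forall>t. step T P (state_of P a) t \<longrightarrow> sat T P \<phi> (env_of xs a) t)"
    unfolding vsat_def by (metis vstep_ex[OF disjoint] vstep_def)
  ultimately show ?thesis by (simp only: vsat_def sat_AX[OF state_of_states])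
qed

lemma vsat_EX:
  "vsat T P (E (X \<phi>)) xs a \<longleftrightarrow> (\<exists>b. vstep T P xs a b \<and> vsat T P \<phi> xs b)"
  unfolding vsat_def sat_EX by (metis vstep_ex[OF disjoint] vstep_def)

text \<open>A set of valuations is not a set of states. The state invariant asks for some valuation
  in \<open>I\<close> above the state whose environment is that of the starting valuation; steps
  never change the environment, so it is preserved.\<close>

lemma vsat_AG_coinduct:
  assumes "I a"
    and "\<And>b. I b \<Longrightarrow> vsat T P \<phi> xs b"
    and "\<And>b c. I b \<Longrightarrow> vstep T P xs b c \<Longrightarrow> I c"
  shows "vsat T P (A (G \<phi>)) xs a"
  unfolding vsat_def
proof (rule sat_AG_coinduct[where I = "\<lambda>t. \<exists>b. I b \<and> t = state_of P b \<and> env_of xs b = env_of xs a"])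
  show "\<exists>b. I b \<and> state_of P a = state_of P b \<and> env_of xs b = env_of xs a"
    using assms(1) by blast
  show "sat T P \<phi> (env_of xs a) t" if "\<exists>b. I b \<and> t = state_of P b \<and> env_of xs b = env_of xs a" for t
    using that assms(2) unfolding vsat_def by metis
  show "\<exists>b. I b \<and> t' = state_of P b \<and> env_of xs b = env_of xs a"
    if "\<exists>b. I b \<and> t = state_of P b \<and> env_of xs b = env_of xs a" "step T P t t'" for t t'
    using that assms(3) vstep_ex[OF disjoint] by metis
qed

lemma vsat_AG_unfold:
  assumes "vsat T P (A (G \<phi>)) xs a"
  shows "vsat T P \<phi> xs a" and "vstep T P xs a b \<Longrightarrow> vsat T P (A (G \<phi>)) xs b"
  using assms sat_AG_unfold[OF state_of_states] unfolding vsat_def vstep_def by metis+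

lemma vsat_EG_coinduct:
  assumes "I a"
    and "\<And>b. I b \<Longrightarrow> vsat T P \<phi> xs b"
    and "\<And>b c. I b \<Longrightarrow> vstep T P xs b c \<Longrightarrow> \<exists>c. vstep T P xs b c \<and> I c"
  shows "vsat T P (E (G \<phi>)) xs a"
  unfolding vsat_def
proof (rule sat_EG_coinduct[where I = "\<lambda>t. \<exists>b. I b \<and> t = state_of P b \<and> env_of xs b = env_of xs a"])
  show "\<exists>b. I b \<and> state_of P a = state_of P b \<and> env_of xs b = env_of xs a"
    using assms(1) by blast
  show "sat T P \<phi> (env_of xs a) t" if "\<exists>b. I b \<and> t = state_of P b \<and> env_of xs b = env_of xs a" for t
    using that assms(2) unfolding vsat_def by metis
  show "\<exists>t'. step T P t t' \<and> (\<exists>b. I b \<and> t' = state_of P b \<and> env_of xs b = env_of xs a)"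
    if t: "\<exists>b. I b \<and> t = state_of P b \<and> env_of xs b = env_of xs a" "step T P t t'" for t t'
  proof -
    from t obtain b where b: "I b" "t = state_of P b" "env_of xs b = env_of xs a" by blast
    with t(2) obtain c where "vstep T P xs b c" using vstep_ex[OF disjoint] by metis
    with b(1) obtain c where "vstep T P xs b c" "I c" using assms(3) by blast
    with b show ?thesis unfolding vstep_def by metis
  qed
qed simp

lemma vsat_EG_unfold:
  assumes "vsat T P (E (G \<phi>)) xs a"
  shows "vsat T P \<phi> xs a"
    and "vstep T P xs a b \<Longrightarrow> \<exists>b. vstep T P xs a b \<and> vsat T P (E (G \<phi>)) xs b"
proof -
  show "vsat T P \<phi> xs a" using assms sat_EG_unfold(1) unfolding vsat_def by metis
  assume "vstep T P xs a b"
  then obtain t where "step T P (state_of P a) t" "sat T P (E (G \<phi>)) (env_of xs a) t"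
    using assms sat_EG_unfold(2) unfolding vsat_def vstep_def by metis
  then show "\<exists>b. vstep T P xs a b \<and> vsat T P (E (G \<phi>)) xs b"
    unfolding vsat_def by (metis vstep_ex[OF disjoint])
qed

lemma vsat_AU_induct:
  assumes "I a"
    and progress: "\<And>b. I b \<Longrightarrow> \<not> vsat T P \<psi> xs b \<Longrightarrow> vsat T P \<phi> xs b \<and> (\<exists>c. vstep T P xs b c)"
    and preserve: "\<And>b c. I b \<Longrightarrow> \<not> vsat T P \<psi> xs b \<Longrightarrow> vstep T P xs b c \<Longrightarrow> I c"
    and chain: "\<not> (\<exists>u. \<forall>i. I (u i) \<and> \<not> vsat T P \<psi> xs (u i) \<and> vstep T P xs (u i) (u (Suc i)))"
  shows "vsat T P (A (U \<phi> \<psi>)) xs a"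
  unfolding vsat_def
proof (rule sat_AU_induct[where I = "\<lambda>t. \<exists>b. I b \<and> t = state_of P b \<and> env_of xs b = env_of xs a"])
  let ?I = "\<lambda>t. \<exists>b. I b \<and> t = state_of P b \<and> env_of xs b = env_of xs a"
  show "?I (state_of P a)"
    using assms(1) by blast
  show "sat T P \<phi> (env_of xs a) t \<and> (\<exists>t'. step T P t t')"
    if t: "?I t" "\<not> sat T P \<psi> (env_of xs a) t" for t
    using t progress unfolding vsat_def vstep_def by metis
  show "?I t'" if t: "?I t" "\<not> sat T P \<psi> (env_of xs a) t" "step T P t t'" for t t'
  proof -
    from t obtain b where b: "I b" "t = state_of P b" "env_of xs b = env_of xs a" by blast
    with t(3) obtain c where c: "vstep T P xs b c" "t' = state_of P c" "env_of xs c = env_of xs b"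
      using vstep_ex[OF disjoint] by metis
    have "\<not> vsat T P \<psi> xs b" using t(2) b unfolding vsat_def by metis
    with preserve b(1) c(1) have "I c" by blast
    with b c show ?thesis by auto
  qed
  show "\<not> (\<exists>u. u 0 = state_of P a \<and>
    (\<forall>i. ?I (u i) \<and> \<not> sat T P \<psi> (env_of xs a) (u i) \<and> step T P (u i) (u (Suc i))))"
  proof
    assume "\<exists>u. u 0 = state_of P a \<and>
      (\<forall>i. ?I (u i) \<and> \<not> sat T P \<psi> (env_of xs a) (u i) \<and> step T P (u i) (u (Suc i)))"
    then obtain u where "\<forall>i. ?I (u i)"
      and u: "\<not> sat T P \<psi> (env_of xs a) (u i)" "step T P (u i) (u (Suc i))" for i by blast
    \<comment> \<open>Choosing a valuation above each state turns the chain of states into a chain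
      of valuations. Consecutive choices are related by \<open>vstep\<close> because all of them
      share the environment of \<open>a\<close>.\<close>
    from choice[OF this(1)] obtain w
      where w: "I (w i)" "u i = state_of P (w i)" "env_of xs (w i) = env_of xs a" for i by blast
    have "\<forall>i. I (w i) \<and> \<not> vsat T P \<psi> xs (w i) \<and> vstep T P xs (w i) (w (Suc i))"
      using w(1,3) u unfolding w(2) vsat_def vstep_def by simp
    with chain show False by blast
  qed
qed

lemma vsat_AU_unfold:
  assumes "vsat T P (A (U \<phi> \<psi>)) xs a" and "\<not> vsat T P \<psi> xs a"
  shows "vsat T P \<phi> xs a" and "\<exists>b. vstep T P xs a b"
    and "vstep T P xs a b \<Longrightarrow> vsat T P (A (U \<phi> \<psi>)) xs b"
proof -
  note unfold = sat_AU_unfold[OF state_of_states assms[unfolded vsat_def]]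
  show "vsat T P \<phi> xs a" using unfold(1) unfolding vsat_def .
  show "\<exists>b. vstep T P xs a b" using unfold(2) vstep_ex[OF disjoint] by metis
  show "vsat T P (A (U \<phi> \<psi>)) xs b" if "vstep T P xs a b"
    using that unfold(3) unfolding vsat_def vstep_def by metis
qed

lemma vsat_AU_no_chain:
  "\<not> (\<forall>i. vsat T P (A (U \<phi> \<psi>)) xs (u i) \<and> \<not> vsat T P \<psi> xs (u i) \<and> vstep T P xs (u i) (u (Suc i)))"
proof
  assume \<section>: "\<forall>i. vsat T P (A (U \<phi> \<psi>)) xs (u i) \<and> \<not> vsat T P \<psi> xs (u i) \<and> vstep T P xs (u i) (u (Suc i))"
  \<comment> \<open>The environment is constant along the chain, so one fixed environment serves for
    its projection to states.\<close>
  have e: "env_of xs (u i) = env_of xs (u 0)" for i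
    by (induction i) (use \<section> in \<open>auto simp: vstep_def\<close>)
  have "sat T P (A (U \<phi> \<psi>)) (env_of xs (u 0)) (state_of P (u i)) \<and>
      \<not> sat T P \<psi> (env_of xs (u 0)) (state_of P (u i)) \<and>
      step T P (state_of P (u i)) (state_of P (u (Suc i)))" for i
    using \<section>[rule_format, of i] e[of i] unfolding vsat_def vstep_def by metis
  with sat_AU_no_chain[of T P \<phi> \<psi> "env_of xs (u 0)" "\<lambda>i. state_of P (u i)"] show False by blast
qed

definition vdist :: "('f, 'p, 'x) sform \<Rightarrow> ('f, 'p, 'x) sform \<Rightarrow> ('x \<Rightarrow> 'd) \<Rightarrow> nat" where
  "vdist \<phi> \<psi> a = until_dist T P \<phi> \<psi> (env_of xs a) (state_of P a)"

lemma vdist_cong: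
  "map a (pvars P @ xs) = map b (pvars P @ xs) \<Longrightarrow> vdist \<phi> \<psi> a = vdist \<phi> \<psi> b"
  unfolding vdist_def by (metis state_of_cong env_of_cong)

lemma vsat_EU_unfold:
  assumes "vsat T P (E (U \<phi> \<psi>)) xs a" and "\<not> vsat T P \<psi> xs a"
  shows "vsat T P \<phi> xs a"
    and "\<exists>b. vstep T P xs a b \<and> vsat T P (E (U \<phi> \<psi>)) xs b \<and> vdist \<phi> \<psi> b < vdist \<phi> \<psi> a"
proof -
  note unfold = sat_EU_unfold[OF state_of_states assms[unfolded vsat_def]]
  show "vsat T P \<phi> xs a" using unfold unfolding vsat_def by blast
  from unfold obtain t where t: "step T P (state_of P a) t"
    "sat T P (E (U \<phi> \<psi>)) (env_of xs a) t"
    "until_dist T P \<phi> \<psi> (env_of xs a) t < until_dist T P \<phi> \<psi> (env_of xs a) (state_of P a)"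
    by blast
  from vstep_ex[OF disjoint t(1)] obtain b
    where b: "vstep T P xs a b" "t = state_of P b" "env_of xs b = env_of xs a" .
  show "\<exists>b. vstep T P xs a b \<and> vsat T P (E (U \<phi> \<psi>)) xs b \<and> vdist \<phi> \<psi> b < vdist \<phi> \<psi> a"
    using t b unfolding vsat_def vdist_def by metis
qed

lemma vsat_EU_intro:
  assumes "vsat T P \<psi> xs a \<or> vsat T P \<phi> xs a \<and> (\<exists>b. vstep T P xs a b \<and> vsat T P (E (U \<phi> \<psi>)) xs b)"
  shows "vsat T P (E (U \<phi> \<psi>)) xs a"
  unfolding vsat_def using assms
  by (intro sat_EU_intro[OF state_of_states]) (metis vsat_def vstep_def)

text \<open>If the formula fails at a point of \<open>I\<close>, then \<psi> fails there, and the
  successor supplied by \<open>progress\<close> violates the formula too, since otherwise it could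
  be folded back. Dependent choice then yields an infinite \<open>R\<close>-chain; no path has to be
  constructed.\<close>

lemma vsat_EU_induct:
  assumes "I a"
    and progress: "\<And>b. I b \<Longrightarrow> \<not> vsat T P \<psi> xs b \<Longrightarrow>
      vsat T P \<phi> xs b \<and> (\<exists>c. vstep T P xs b c \<and> I c \<and> R b c)"
    and chain: "\<not> (\<exists>u. \<forall>i. R (u i) (u (Suc i)))"
  shows "vsat T P (E (U \<phi> \<psi>)) xs a"
proof (rule ccontr)
  let ?J = "\<lambda>b. I b \<and> \<not> vsat T P (E (U \<phi> \<psi>)) xs b"
  assume "\<not> vsat T P (E (U \<phi> \<psi>)) xs a"
  with \<open>I a\<close> have "?J a" by blast
  moreover have "\<exists>c. ?J c \<and> R b c" if "?J b" for b
    using that progress vsat_EU_intro by meson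
  ultimately obtain u where "\<forall>i::nat. ?J (u i) \<and> R (u i) (u (Suc i))"
    using dependent_nat_choice[of "\<lambda>_. ?J" "\<lambda>_. R"] by metis
  with chain show False by blast
qed

end

section \<open>Constraints as conditions on valuations\<close>

lemma case_pvar_comp: "case_pvar (\<sigma> \<circ> Unprimed) (\<sigma> \<circ> Primed) = \<sigma>"
  by (auto simp: fun_eq_iff split: pvar.splits)

text \<open>A valuation of unprimed and primed variables amounts to a pair of valuations, the
  current one and the next one.\<close>

lemma sat_Imp:
  "sat_constraint T Q (Imp \<alpha> \<beta>) \<longleftrightarrow>
     (\<forall>a b. holds (expand T Q) (case_pvar a b) \<alpha> \<longrightarrow> holds (expand T Q) (case_pvar a b) \<beta>)"
  unfolding sat_constraint.simps by (metis case_pvar_comp)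

lemma holds_q0: "holds (expand T Q) (case_pvar a b) (q0 q v) \<longleftrightarrow> map a v \<in> Q q"
  by (simp add: expand_def comp_def)

lemma holds_q1: "holds (expand T Q) (case_pvar a b) (q1 q v) \<longleftrightarrow> map b v \<in> Q q"
  by (simp add: expand_def comp_def)

lemma holds_q01: "holds (expand T Q) (case_pvar a b) (q01 q v) \<longleftrightarrow> map a v @ map b v \<in> Q q"
  by (simp add: expand_def comp_def)

lemma holds_frozen: "holds T (case_pvar a b) (frozen x) \<longleftrightarrow> b x = a x"
  by simp

lemma holds_ExF_Unprimed:
  "holds T (case_pvar a b) (ExF (Unprimed x) \<alpha>) \<longleftrightarrow> (\<exists>d. holds T (case_pvar (a(x := d)) b) \<alpha>)"
proof -
  have "(case_pvar a b)(Unprimed x := d) = case_pvar (a(x := d)) b" for d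
    by (auto simp: fun_eq_iff split: pvar.splits)
  then show ?thesis by simp
qed

lemma holds_Ex_primed:
  "holds T (case_pvar a b) (Ex_primed v \<alpha>) \<longleftrightarrow>
     (\<exists>c. holds T (case_pvar a (\<lambda>y. if y \<in> set v then c y else b y)) \<alpha>)"
proof (induction v arbitrary: b)
  case (Cons x v)
  have upd: "(case_pvar a b)(Primed x := d) = case_pvar a (b(x := d))" for d
    by (auto simp: fun_eq_iff split: pvar.splits)
  have "(\<exists>d c. holds T (case_pvar a (\<lambda>y. if y \<in> set v then c y else (b(x := d)) y)) \<alpha>) \<longleftrightarrow>
    (\<exists>c. holds T (case_pvar a (\<lambda>y. if y \<in> set (x # v) then c y else b y)) \<alpha>)"
  proof safe
    fix d c
    assume "holds T (case_pvar a (\<lambda>y. if y \<in> set v then c y else (b(x := d)) y)) \<alpha>"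
    \<comment> \<open>If \<open>x\<close> occurs again in \<open>v\<close>, the inner quantifier
      overrides the outer one, so \<open>d\<close> is used only when it does not. This way
      \<open>v\<close> may contain repetitions.\<close>
    moreover have "(\<lambda>y. if y \<in> set v then c y else (b(x := d)) y) =
      (\<lambda>y. if y \<in> set (x # v) then (if y \<in> set v then c y else d) else b y)"
      by (auto simp: fun_eq_iff)
    ultimately show "\<exists>c. holds T (case_pvar a (\<lambda>y. if y \<in> set (x # v) then c y else b y)) \<alpha>"
      by (metis (no_types))
  next
    fix c
    assume "holds T (case_pvar a (\<lambda>y. if y \<in> set (x # v) then c y else b y)) \<alpha>"
    moreover have "(\<lambda>y. if y \<in> set (x # v) then c y else b y) =
      (\<lambda>y. if y \<in> set v then c y else (b(x := c x)) y)"
      by (auto simp: fun_eq_iff)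
    ultimately show "\<exists>d c. holds T (case_pvar a (\<lambda>y. if y \<in> set v then c y else (b(x := d)) y)) \<alpha>"
      by (metis (no_types))
  qed
  then show ?case by (simp only: list.map foldr.simps comp_apply holds.simps upd Cons.IH)
qed simp

text \<open>The quantifier block changes only the values on \<open>v\<close>. If nothing else
  influences the body, quantifying over \<open>v\<close> is the same as quantifying over whole
  valuations.\<close>

lemma holds_Ex_primed_iff:
  assumes "\<And>c. holds T (case_pvar a c) \<alpha> \<longleftrightarrow> R c"
    and "\<And>c c'. map c v = map c' v \<Longrightarrow> R c \<longleftrightarrow> R c'"
  shows "holds T (case_pvar a b) (Ex_primed v \<alpha>) \<longleftrightarrow> (\<exists>c. R c)"
proof -
  have "R (\<lambda>y. if y \<in> set v then c y else b y) \<longleftrightarrow> R c" for c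
    by (rule assms(2)) simp
  then show ?thesis unfolding holds_Ex_primed assms(1) by simp
qed

section \<open>Interpretations of query symbols as sets of value tuples\<close>

definition tuples :: "'x list \<Rightarrow> (('x \<Rightarrow> 'd) \<Rightarrow> bool) \<Rightarrow> 'd list set" where
  "tuples v I = {map a v | a. I a}"

definition tuples2 :: "'x list \<Rightarrow> (('x \<Rightarrow> 'd) \<Rightarrow> ('x \<Rightarrow> 'd) \<Rightarrow> bool) \<Rightarrow> 'd list set" where
  "tuples2 v R = {map a v @ map b v | a b. R a b}"

lemma length_tuples: "ds \<in> tuples v I \<Longrightarrow> length ds = length v"
  by (auto simp: tuples_def)

lemma length_tuples2: "ds \<in> tuples2 v R \<Longrightarrow> length ds = 2 * length v"
  by (auto simp: tuples2_def)

text \<open>\<open>tuples\<close> is an image, so membership reflects \<open>I\<close> only if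
  \<open>I\<close> does not distinguish valuations with equal tuples.\<close>

lemma in_tuples:
  assumes "\<And>a b. map a v = map b v \<Longrightarrow> I a \<longleftrightarrow> I b"
  shows "map a v \<in> tuples v I \<longleftrightarrow> I a"
  unfolding tuples_def using assms by blast

lemma in_tuples2:
  assumes "\<And>a a' b b'. map a v = map a' v \<Longrightarrow> map b v = map b' v \<Longrightarrow> R a b \<longleftrightarrow> R a' b'"
  shows "map a v @ map b v \<in> tuples2 v R \<longleftrightarrow> R a b"
proof
  assume "map a v @ map b v \<in> tuples2 v R"
  then obtain a' b' where "map a v = map a' v" "map b v = map b' v" "R a' b'"
    by (auto simp: tuples2_def)
  with assms show "R a b" by blast
qed (auto simp: tuples2_def)

text \<open>A chain of lists has to be lifted to a chain of valuations. Each \<open>u i\<close> is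
  the first half of a member of \<open>tuples2 v R\<close>, hence the value tuple of some valuation;
  its length alone would not show this when \<open>v\<close> repeats a variable.\<close>

lemma sat_Wf_tuples2:
  assumes "\<And>a a' b b'. map a v = map a' v \<Longrightarrow> map b v = map b' v \<Longrightarrow> R a b \<longleftrightarrow> R a' b'"
    and "Q q = tuples2 v R" and "arity q = 2 * length v"
    and "\<not> (\<exists>u. \<forall>i::nat. R (u i) (u (Suc i)))"
  shows "sat_constraint T Q (Wf q)"
proof -
  have False if u: "\<And>i. length (u i) = length v" "\<And>i. u i @ u (Suc i) \<in> tuples2 v R" for u :: "nat \<Rightarrow> _"
  proof -
    have "\<exists>a. map a v = u i" for i
      using u[of i] by (force simp: tuples2_def)
    then obtain w where w: "map (w i) v = u i" for i by metis
    have "R (w i) (w (Suc i))" for i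
      using in_tuples2[of v R "w i" "w (Suc i)", OF assms(1)] u(2)[of i] unfolding w by blast
    with assms(4) show False by blast
  qed
  then show ?thesis using assms(2,3) by auto
qed

lemma sat_Wf_no_chain:
  assumes "sat_constraint T Q (Wf q)" and "arity q = 2 * length v"
  shows "\<not> (\<exists>u. \<forall>i::nat. map (u i) v @ map (u (Suc i)) v \<in> Q q)"
proof
  assume "\<exists>u. \<forall>i::nat. map (u i) v @ map (u (Suc i)) v \<in> Q q"
  then obtain u where "\<forall>i::nat. map (u i) v @ map (u (Suc i)) v \<in> Q q" by blast
  then have "\<forall>i. length (map (u i) v) = arity q div 2 \<and> map (u i) v @ map (u (Suc i)) v \<in> Q q"
    using assms(2) by simp
  with assms(1) show False
    unfolding sat_constraint.simps not_ex by (blast dest: spec[of _ "\<lambda>i. map (u i) v"])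
qed

section \<open>Scoping and induction along the rules of \<open>gen\<close>\<close>

lemmas constraint_simps =
  sat_Imp holds_q0 holds_q1 holds_q01 holds.simps(4-6)

lemma in_scope_simps:
  "in_scope P xs (Forall x \<phi>) \<longleftrightarrow> in_scope P (xs @ [x]) \<phi> \<and> x \<notin> set (pvars P @ xs)"
  "in_scope P xs (Exists x \<phi>) \<longleftrightarrow> in_scope P (xs @ [x]) \<phi> \<and> x \<notin> set (pvars P @ xs)"
  "in_scope P xs (Conj \<phi> \<psi>) \<longleftrightarrow> in_scope P xs \<phi> \<and> in_scope P xs \<psi>"
  "in_scope P xs (Disj \<phi> \<psi>) \<longleftrightarrow> in_scope P xs \<phi> \<and> in_scope P xs \<psi>"
  "in_scope P xs (A (X \<phi>)) \<longleftrightarrow> in_scope P xs \<phi>"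
  "in_scope P xs (A (G \<phi>)) \<longleftrightarrow> in_scope P xs \<phi>"
  "in_scope P xs (A (U \<phi> \<psi>)) \<longleftrightarrow> in_scope P xs \<phi> \<and> in_scope P xs \<psi>"
  "in_scope P xs (E (X \<phi>)) \<longleftrightarrow> in_scope P xs \<phi>"
  "in_scope P xs (E (G \<phi>)) \<longleftrightarrow> in_scope P xs \<phi>"
  "in_scope P xs (E (U \<phi> \<psi>)) \<longleftrightarrow> in_scope P xs \<phi> \<and> in_scope P xs \<psi>"
  by (auto simp: in_scope_def)

text \<open>\<open>gen\<close> consumes a path quantifier together with the temporal operator below
  it. The mutual induction is recast accordingly, by proving the property for a path formula under
  both quantifiers at once.\<close>

lemma sform_flat_induct [case_names Forall Exists Assn Conj Disj AX AG AU EX EG EU]: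
  assumes "\<And>x \<phi>. H \<phi> \<Longrightarrow> H (Forall x \<phi>)"
    and "\<And>x \<phi>. H \<phi> \<Longrightarrow> H (Exists x \<phi>)"
    and "\<And>c. H (Assn c)"
    and "\<And>\<phi> \<psi>. H \<phi> \<Longrightarrow> H \<psi> \<Longrightarrow> H (Conj \<phi> \<psi>)"
    and "\<And>\<phi> \<psi>. H \<phi> \<Longrightarrow> H \<psi> \<Longrightarrow> H (Disj \<phi> \<psi>)"
    and "\<And>\<phi>. H \<phi> \<Longrightarrow> H (A (X \<phi>))"
    and "\<And>\<phi>. H \<phi> \<Longrightarrow> H (A (G \<phi>))"
    and "\<And>\<phi> \<psi>. H \<phi> \<Longrightarrow> H \<psi> \<Longrightarrow> H (A (U \<phi> \<psi>))"
    and "\<And>\<phi>. H \<phi> \<Longrightarrow> H (E (X \<phi>))"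
    and "\<And>\<phi>. H \<phi> \<Longrightarrow> H (E (G \<phi>))"
    and "\<And>\<phi> \<psi>. H \<phi> \<Longrightarrow> H \<psi> \<Longrightarrow> H (E (U \<phi> \<psi>))"
  shows "H (\<phi> :: ('f, 'p, 'x) sform)"
proof -
  have "H \<phi>" and "H (A \<alpha>) \<and> H (E \<alpha>)" for \<alpha> :: "('f, 'p, 'x) pform"
    by (induction \<phi> and \<alpha>) (use assms in auto)
  then show ?thesis by blast
qed

lemma holds_Ex_next:
  assumes v: "v = pvars P @ xs"
    and nxt: "\<And>a b. holds (expand T Q) (case_pvar a b) nxt \<longleftrightarrow> vstep T P xs a b"
  shows "holds (expand T Q) (case_pvar a b) (Ex_primed v nxt) \<longleftrightarrow> (\<exists>c. vstep T P xs a c)"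
    and "holds (expand T Q) (case_pvar a b) (Ex_primed v (AndF nxt (q1 q v))) \<longleftrightarrow>
      (\<exists>c. vstep T P xs a c \<and> map c v \<in> Q q)"
    and "holds (expand T Q) (case_pvar a b) (Ex_primed v (AndF nxt (AndF (q1 q v) (q01 r v)))) \<longleftrightarrow>
      (\<exists>c. vstep T P xs a c \<and> map c v \<in> Q q \<and> map a v @ map c v \<in> Q r)"
proof -
  have cong: "map c v = map c' v \<Longrightarrow> vstep T P xs a c \<longleftrightarrow> vstep T P xs a c'" for c c'
    using vstep_cong unfolding v by blast
  show "holds (expand T Q) (case_pvar a b) (Ex_primed v nxt) \<longleftrightarrow> (\<exists>c. vstep T P xs a c)"
    by (rule holds_Ex_primed_iff, simp only: nxt) (rule cong)
  show "holds (expand T Q) (case_pvar a b) (Ex_primed v (AndF nxt (q1 q v))) \<longleftrightarrow>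
      (\<exists>c. vstep T P xs a c \<and> map c v \<in> Q q)"
    by (rule holds_Ex_primed_iff, simp only: nxt holds.simps(5) holds_q1) (metis cong)
  show "holds (expand T Q) (case_pvar a b) (Ex_primed v (AndF nxt (AndF (q1 q v) (q01 r v)))) \<longleftrightarrow>
      (\<exists>c. vstep T P xs a c \<and> map c v \<in> Q q \<and> map a v @ map c v \<in> Q r)"
    by (rule holds_Ex_primed_iff, simp only: nxt holds.simps(5) holds_q1 holds_q01) (metis cong)
qed

lemma holds_frozen_next:
  assumes "\<And>a b. holds T' (case_pvar a b) nxt \<longleftrightarrow> vstep T P xs a b"
  shows "holds T' (case_pvar a b) (AndF nxt (frozen x)) \<longleftrightarrow> vstep T P (xs @ [x]) a b"
  by (simp only: holds.simps(5) assms holds_frozen vstep_append)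

lemmas gen_unfold = gen.simps Let_def case_prod_beta fst_conv snd_conv

section \<open>Soundness\<close>

text \<open>\<open>J\<close> is the meaning of the current initial condition. In a recursive call it
  is membership in the guarding query symbol, so the induction hypothesis says that this symbol
  implies its subformula. Dependence on the values of \<open>v\<close> alone is what lets
  \<open>J\<close> survive a change of a newly quantified variable.\<close>

lemma gen_sound:
  fixes \<phi> :: "('f, 'p, 'x) sform"
  assumes "v = pvars P @ xs" and "in_scope P xs \<phi>"
    and "\<forall>c\<in>set (fst (gen \<phi> v ini nxt k)). sat_constraint T Q c"
    and "\<And>a b. holds (expand T Q) (case_pvar a b) nxt \<longleftrightarrow> vstep T P xs a b"
    and "\<And>a b. holds (expand T Q) (case_pvar a b) ini \<longleftrightarrow> J a"
    and "\<And>a b. map a v = map b v \<Longrightarrow> J a \<longleftrightarrow> J b"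
    and "J a"
  shows "vsat T P \<phi> xs a"
  using assms
proof (induction \<phi> arbitrary: xs v ini nxt k J a rule: sform_flat_induct)
  case (Forall x \<phi>)
  note prems = Forall.prems
  have x: "x \<notin> set v" "in_scope P (xs @ [x]) \<phi>" "x \<notin> set (pvars P)"
    using prems(1,2) by (auto simp: in_scope_simps)
  have "vsat T P \<phi> (xs @ [x]) (a(x := d))" for d
  proof (rule Forall.IH[where v = "v @ [x]" and J = J])
    \<comment> \<open>Absence of shadowing enters here: \<open>x\<close> does not occur in
      \<open>v\<close>, so the initial condition holds for every value of \<open>x\<close>.\<close>
    have "map (a(x := d)) v = map a v" using x(1) by auto
    with prems(6,7) show "J (a(x := d))" by blast
    show "\<forall>c\<in>set (fst (gen \<phi> (v @ [x]) ini (AndF nxt (frozen x)) k)). sat_constraint T Q c"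
      using prems(3) by (simp only: gen_unfold)
    show "J b \<longleftrightarrow> J c" if "map b (v @ [x]) = map c (v @ [x])" for b c
      using prems(6) that by simp
    show "v @ [x] = pvars P @ xs @ [x]" by (simp add: prems(1))
  qed (fact x(2) holds_frozen_next[OF prems(4)] prems(5))+
  then show ?case by (simp add: vsat_Forall x(3))
next
  case (Exists x \<phi>)
  note prems = Exists.prems
  have x: "x \<notin> set v" "in_scope P (xs @ [x]) \<phi>" "x \<notin> set (pvars P)"
    using prems(1,2) by (auto simp: in_scope_simps)
  let ?aux = "QSym k (length (v @ [x]))"
  have sat: "\<forall>c\<in>set (fst (gen \<phi> (v @ [x]) (q0 ?aux (v @ [x])) (AndF nxt (frozen x)) (k + 1))).
      sat_constraint T Q c"
    and "sat_constraint T Q (Imp ini (ExF (Unprimed x) (q0 ?aux (v @ [x]))))"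
    using prems(3) unfolding gen_unfold by simp_all
  then obtain d where d: "map (a(x := d)) (v @ [x]) \<in> Q ?aux"
    using prems(5,7) unfolding constraint_simps holds_ExF_Unprimed by blast
  have "vsat T P \<phi> (xs @ [x]) (a(x := d))"
    by (rule Exists.IH[where v = "v @ [x]" and J = "\<lambda>b. map b (v @ [x]) \<in> Q ?aux",
          OF _ x(2) sat holds_frozen_next[OF prems(4)] holds_q0 _ d])
      (simp_all only: prems(1) append_assoc)
  then show ?case unfolding vsat_Exists[OF x(3)] by blast
next
  case (Assn c)
  have inj: "inj Unprimed" by (simp add: inj_def)
  have "fv c \<subseteq> set (pvars P @ xs)" using Assn.prems(2) by (simp add: in_scope_def)
  moreover have "sat_constraint T Q (Imp ini (map_fm (\<lambda>f. f) Inl Unprimed c))"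
    using Assn.prems(3) by (simp only: gen_unfold list.set ball_simps)
  then have "holds T a c"
    using Assn.prems(5,7) unfolding sat_Imp holds_expand_map[OF inj] by (auto simp: comp_def)
  ultimately show ?case by (simp add: vsat_Assn)
next
  case (Conj \<phi> \<psi>)
  note prems = Conj.prems
  let ?aux1 = "QSym k (length v)" and ?aux2 = "QSym (k + 1) (length v)"
  have scope: "in_scope P xs \<phi>" "in_scope P xs \<psi>" using prems(2) by (simp_all only: in_scope_simps)
  let ?g = "gen \<phi> v (q0 ?aux1 v) nxt (k + 2)"
  have cs: "sat_constraint T Q (Imp ini (AndF (q0 ?aux1 v) (q0 ?aux2 v)))"
    and cs1: "\<forall>c\<in>set (fst ?g). sat_constraint T Q c"
    and cs2: "\<forall>c\<in>set (fst (gen \<psi> v (q0 ?aux2 v) nxt (snd ?g))). sat_constraint T Q c"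
    using prems(3) unfolding gen_unfold by (simp_all del: sat_constraint.simps holds.simps)
  have "vsat T P \<phi> xs b" if "map b v \<in> Q ?aux1" for b
    by (rule Conj.IH(1)[OF prems(1) scope(1) cs1 prems(4) holds_q0 _ that]) (simp only:)
  moreover have "vsat T P \<psi> xs b" if "map b v \<in> Q ?aux2" for b
    by (rule Conj.IH(2)[OF prems(1) scope(2) cs2 prems(4) holds_q0 _ that]) (simp only:)
  ultimately show ?case using cs prems(7) by (simp only: constraint_simps prems(5) vsat_Conj)
next
  case (Disj \<phi> \<psi>)
  note prems = Disj.prems
  let ?aux1 = "QSym k (length v)" and ?aux2 = "QSym (k + 1) (length v)"
  have scope: "in_scope P xs \<phi>" "in_scope P xs \<psi>" using prems(2) by (simp_all only: in_scope_simps)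
  let ?g = "gen \<phi> v (q0 ?aux1 v) nxt (k + 2)"
  have cs: "sat_constraint T Q (Imp ini (OrF (q0 ?aux1 v) (q0 ?aux2 v)))"
    and cs1: "\<forall>c\<in>set (fst ?g). sat_constraint T Q c"
    and cs2: "\<forall>c\<in>set (fst (gen \<psi> v (q0 ?aux2 v) nxt (snd ?g))). sat_constraint T Q c"
    using prems(3) unfolding gen_unfold by (simp_all del: sat_constraint.simps holds.simps)
  have "vsat T P \<phi> xs b" if "map b v \<in> Q ?aux1" for b
    by (rule Disj.IH(1)[OF prems(1) scope(1) cs1 prems(4) holds_q0 _ that]) (simp only:)
  moreover have "vsat T P \<psi> xs b" if "map b v \<in> Q ?aux2" for b
    by (rule Disj.IH(2)[OF prems(1) scope(2) cs2 prems(4) holds_q0 _ that]) (simp only:)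
  ultimately show ?case
    using cs prems(7) unfolding constraint_simps prems(5) vsat_Disj by blast
next
  case (AX \<phi>)
  note prems = AX.prems
  let ?aux = "QSym k (length v)"
  have scope: "in_scope P xs \<phi>" using prems(2) by (simp only: in_scope_simps)
  then have disj: "set xs \<inter> set (pvars P) = {}" by (simp add: in_scope_def)
  note next_simps = holds_Ex_next[where nxt = nxt, OF prems(1) prems(4)] prems(4,5)
  have cs: "sat_constraint T Q (Imp ini (Ex_primed v nxt))"
      "sat_constraint T Q (Imp (AndF ini nxt) (q1 ?aux v))"
    and cs1: "\<forall>c\<in>set (fst (gen \<phi> v (q0 ?aux v) nxt (k + 1))). sat_constraint T Q c"
    using prems(3) unfolding gen_unfold by (simp_all del: sat_constraint.simps holds.simps)
  have "vsat T P \<phi> xs b" if "map b v \<in> Q ?aux" for b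
    by (rule AX.IH[OF prems(1) scope cs1 prems(4) holds_q0 _ that]) (simp only:)
  with cs prems(7) show ?case
    unfolding constraint_simps next_simps vsat_AX[OF disj] by blast
next
  case (AG \<phi>)
  note prems = AG.prems
  let ?inv = "QSym k (length v)"
  have scope: "in_scope P xs \<phi>" using prems(2) by (simp only: in_scope_simps)
  then have disj: "set xs \<inter> set (pvars P) = {}" by (simp add: in_scope_def)
  have cs: "sat_constraint T Q (Imp ini (q0 ?inv v))"
      "sat_constraint T Q (Imp (AndF (q0 ?inv v) nxt) (q1 ?inv v))"
    and cs1: "\<forall>c\<in>set (fst (gen \<phi> v (q0 ?inv v) nxt (k + 1))). sat_constraint T Q c"
    using prems(3) unfolding gen_unfold by (simp_all del: sat_constraint.simps holds.simps)
  show ?case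
  proof (rule vsat_AG_coinduct[OF disj, where I = "\<lambda>b. map b v \<in> Q ?inv"])
    show "map a v \<in> Q ?inv" using cs(1) prems(7) by (simp only: constraint_simps prems(5))
    show "vsat T P \<phi> xs b" if "map b v \<in> Q ?inv" for b
      by (rule AG.IH[OF prems(1) scope cs1 prems(4) holds_q0 _ that]) (simp only:)
    show "map c v \<in> Q ?inv" if "map b v \<in> Q ?inv" "vstep T P xs b c" for b c
      using cs(2) that unfolding constraint_simps prems(4) by blast
  qed
next
  case (AU \<phi> \<psi>)
  note prems = AU.prems
  let ?inv = "QSym k (length v)" and ?aux1 = "QSym (k + 1) (length v)"
    and ?aux2 = "QSym (k + 2) (length v)" and ?rank = "QSym (k + 3) (2 * length v)"
  have scope: "in_scope P xs \<phi>" "in_scope P xs \<psi>" using prems(2) by (simp_all only: in_scope_simps)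
  then have disj: "set xs \<inter> set (pvars P) = {}" by (simp add: in_scope_def)
  note next_simps = holds_Ex_next[where nxt = nxt, OF prems(1) prems(4)] prems(4,5)
  let ?g = "gen \<phi> v (q0 ?aux1 v) nxt (k + 4)"
  have cs: "sat_constraint T Q (Imp ini (q0 ?inv v))"
      "sat_constraint T Q (Imp (AndF (q0 ?inv v) (NotF (q0 ?aux2 v))) (AndF (q0 ?aux1 v) (Ex_primed v nxt)))"
      "sat_constraint T Q (Imp (AndF (AndF (q0 ?inv v) (NotF (q0 ?aux2 v))) nxt)
        (AndF (q1 ?inv v) (q01 ?rank v)))"
      "sat_constraint T Q (Wf ?rank :: ('f, 'p, 'x) constraint)"
    and cs1: "\<forall>c\<in>set (fst ?g). sat_constraint T Q c"
    and cs2: "\<forall>c\<in>set (fst (gen \<psi> v (q0 ?aux2 v) nxt (snd ?g))). sat_constraint T Q c"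
    using prems(3) unfolding gen_unfold by (simp_all del: sat_constraint.simps holds.simps)
  have \<phi>: "vsat T P \<phi> xs b" if "map b v \<in> Q ?aux1" for b
    by (rule AU.IH(1)[OF prems(1) scope(1) cs1 prems(4) holds_q0 _ that]) (simp only:)
  have \<psi>: "vsat T P \<psi> xs b" if "map b v \<in> Q ?aux2" for b
    by (rule AU.IH(2)[OF prems(1) scope(2) cs2 prems(4) holds_q0 _ that]) (simp only:)
  \<comment> \<open>Membership in \<open>?aux2\<close> implies \<psi>, hence where \<psi> fails the
    negated premise of the constraints is available.\<close>
  have step: "map c v \<in> Q ?inv \<and> map b v @ map c v \<in> Q ?rank"
    if "map b v \<in> Q ?inv" "\<not> vsat T P \<psi> xs b" "vstep T P xs b c" for b c
    using cs(3) that \<psi> unfolding constraint_simps prems(4) by blast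
  have chain: "\<not> (\<exists>u. \<forall>i::nat. map (u i) v @ map (u (Suc i)) v \<in> Q ?rank)"
    using sat_Wf_no_chain[OF cs(4), of v] by simp
  show ?case
  proof (rule vsat_AU_induct[OF disj, where I = "\<lambda>b. map b v \<in> Q ?inv"])
    show "map a v \<in> Q ?inv" using cs(1) prems(7) by (simp only: constraint_simps prems(5))
    show "vsat T P \<phi> xs b \<and> (\<exists>c. vstep T P xs b c)"
      if "map b v \<in> Q ?inv" "\<not> vsat T P \<psi> xs b" for b
      using cs(2) that \<phi> \<psi> unfolding constraint_simps next_simps by blast
    show "map c v \<in> Q ?inv"
      if "map b v \<in> Q ?inv" "\<not> vsat T P \<psi> xs b" "vstep T P xs b c" for b c
      using step that by blast
    show "\<not> (\<exists>u. \<forall>i. map (u i) v \<in> Q ?inv \<and> \<not> vsat T P \<psi> xs (u i) \<and> vstep T P xs (u i) (u (Suc i)))"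
      using step chain by blast
  qed
next
  case (EX \<phi>)
  note prems = EX.prems
  let ?aux = "QSym k (length v)"
  have scope: "in_scope P xs \<phi>" using prems(2) by (simp only: in_scope_simps)
  then have disj: "set xs \<inter> set (pvars P) = {}" by (simp add: in_scope_def)
  note next_simps = holds_Ex_next[where nxt = nxt, OF prems(1) prems(4)] prems(4,5)
  have cs: "sat_constraint T Q (Imp ini (Ex_primed v (AndF nxt (q1 ?aux v))))"
    and cs1: "\<forall>c\<in>set (fst (gen \<phi> v (q0 ?aux v) nxt (k + 1))). sat_constraint T Q c"
    using prems(3) unfolding gen_unfold by (simp_all del: sat_constraint.simps holds.simps)
  have "vsat T P \<phi> xs b" if "map b v \<in> Q ?aux" for b
    by (rule EX.IH[OF prems(1) scope cs1 prems(4) holds_q0 _ that]) (simp only:)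
  with cs prems(7) show ?case
    unfolding constraint_simps next_simps vsat_EX[OF disj] by blast
next
  case (EG \<phi>)
  note prems = EG.prems
  let ?inv = "QSym k (length v)"
  have scope: "in_scope P xs \<phi>" using prems(2) by (simp only: in_scope_simps)
  then have disj: "set xs \<inter> set (pvars P) = {}" by (simp add: in_scope_def)
  note next_simps = holds_Ex_next[where nxt = nxt, OF prems(1) prems(4)] prems(4,5)
  have cs: "sat_constraint T Q (Imp ini (q0 ?inv v))"
      "sat_constraint T Q (Imp (AndF (q0 ?inv v) nxt) (Ex_primed v (AndF nxt (q1 ?inv v))))"
    and cs1: "\<forall>c\<in>set (fst (gen \<phi> v (q0 ?inv v) nxt (k + 1))). sat_constraint T Q c"
    using prems(3) unfolding gen_unfold by (simp_all del: sat_constraint.simps holds.simps)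
  show ?case
  proof (rule vsat_EG_coinduct[OF disj, where I = "\<lambda>b. map b v \<in> Q ?inv"])
    show "map a v \<in> Q ?inv" using cs(1) prems(7) by (simp only: constraint_simps prems(5))
    show "vsat T P \<phi> xs b" if "map b v \<in> Q ?inv" for b
      by (rule EG.IH[OF prems(1) scope cs1 prems(4) holds_q0 _ that]) (simp only:)
    show "\<exists>c. vstep T P xs b c \<and> map c v \<in> Q ?inv"
      if "map b v \<in> Q ?inv" "vstep T P xs b c" for b c
      using cs(2) that unfolding constraint_simps next_simps by blast
  qed
next
  case (EU \<phi> \<psi>)
  note prems = EU.prems
  have scope: "in_scope P xs \<phi>" "in_scope P xs \<psi>" using prems(2) by (simp_all only: in_scope_simps)
  then have disj: "set xs \<inter> set (pvars P) = {}" by (simp add: in_scope_def)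
  note next_simps = holds_Ex_next[where nxt = nxt, OF prems(1) prems(4)] prems(4,5)
  let ?inv = "QSym k (length v)"
  \<comment> \<open>Both rules for existential until yield these facts, differing in the symbols
    involved and in how \<phi> is obtained; the well-founded argument then runs once for
    either.\<close>
  obtain rank where arity: "arity rank = 2 * length v"
    and ini: "sat_constraint T Q (Imp ini (q0 ?inv v))" and wf: "sat_constraint T Q (Wf rank :: ('f, 'p, 'x) constraint)"
    and step: "\<And>b. map b v \<in> Q ?inv \<Longrightarrow> \<not> vsat T P \<psi> xs b \<Longrightarrow> vsat T P \<phi> xs b \<and>
      (\<exists>c. vstep T P xs b c \<and> map c v \<in> Q ?inv \<and> map b v @ map c v \<in> Q rank)"
  proof (cases "\<phi> = Assn TrueF")
    case True
    let ?aux = "QSym (k + 1) (length v)" and ?rank = "QSym (k + 2) (2 * length v)"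
    have cs: "sat_constraint T Q (Imp ini (q0 ?inv v))" "sat_constraint T Q (Wf ?rank :: ('f, 'p, 'x) constraint)"
      "sat_constraint T Q (Imp (AndF (q0 ?inv v) (NotF (q0 ?aux v)))
        (Ex_primed v (AndF nxt (AndF (q1 ?inv v) (q01 ?rank v)))))"
      and cs1: "\<forall>c\<in>set (fst (gen \<psi> v (q0 ?aux v) nxt (k + 3))). sat_constraint T Q c"
      using prems(3)
      unfolding True simp_thms if_True gen_unfold by (simp_all del: sat_constraint.simps holds.simps)
    have \<psi>: "vsat T P \<psi> xs b" if "map b v \<in> Q ?aux" for b
      by (rule EU.IH(2)[OF prems(1) scope(2) cs1 prems(4) holds_q0 _ that]) (simp only:)
    show thesis
    proof (rule that[of ?rank])
      show "vsat T P \<phi> xs b \<and>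
          (\<exists>c. vstep T P xs b c \<and> map c v \<in> Q ?inv \<and> map b v @ map c v \<in> Q ?rank)"
        if "map b v \<in> Q ?inv" "\<not> vsat T P \<psi> xs b" for b
      proof
        show "vsat T P \<phi> xs b" by (simp add: True vsat_def)
        show "\<exists>c. vstep T P xs b c \<and> map c v \<in> Q ?inv \<and> map b v @ map c v \<in> Q ?rank"
          using cs(3) that \<psi> unfolding constraint_simps next_simps by blast
      qed
    qed (use cs in simp_all)
  next
    case False
    let ?aux1 = "QSym (k + 1) (length v)" and ?aux2 = "QSym (k + 2) (length v)"
      and ?rank = "QSym (k + 3) (2 * length v)"
    let ?g = "gen \<phi> v (q0 ?aux1 v) nxt (k + 4)"
    have cs: "sat_constraint T Q (Imp ini (q0 ?inv v))" "sat_constraint T Q (Wf ?rank :: ('f, 'p, 'x) constraint)"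
      "sat_constraint T Q (Imp (AndF (q0 ?inv v) (NotF (q0 ?aux2 v)))
        (AndF (q0 ?aux1 v) (Ex_primed v (AndF nxt (AndF (q1 ?inv v) (q01 ?rank v))))))"
      and cs1: "\<forall>c\<in>set (fst ?g). sat_constraint T Q c"
      and cs2: "\<forall>c\<in>set (fst (gen \<psi> v (q0 ?aux2 v) nxt (snd ?g))). sat_constraint T Q c"
      using prems(3)
      unfolding gen_unfold if_not_P[OF False] by (simp_all del: sat_constraint.simps holds.simps)
    have \<phi>: "vsat T P \<phi> xs b" if "map b v \<in> Q ?aux1" for b
      by (rule EU.IH(1)[OF prems(1) scope(1) cs1 prems(4) holds_q0 _ that]) (simp only:)
    have \<psi>: "vsat T P \<psi> xs b" if "map b v \<in> Q ?aux2" for b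
      by (rule EU.IH(2)[OF prems(1) scope(2) cs2 prems(4) holds_q0 _ that]) (simp only:)
    show thesis
    proof (rule that[of ?rank])
      show "vsat T P \<phi> xs b \<and>
          (\<exists>c. vstep T P xs b c \<and> map c v \<in> Q ?inv \<and> map b v @ map c v \<in> Q ?rank)"
        if "map b v \<in> Q ?inv" "\<not> vsat T P \<psi> xs b" for b
        using cs(3) that \<phi> \<psi> unfolding constraint_simps next_simps by blast
    qed (use cs in simp_all)
  qed
  have chain: "\<not> (\<exists>u. \<forall>i::nat. map (u i) v @ map (u (Suc i)) v \<in> Q rank)"
    using sat_Wf_no_chain[OF wf arity] .
  show ?case
  proof (rule vsat_EU_induct[OF disj, where I = "\<lambda>b. map b v \<in> Q ?inv"
        and R = "\<lambda>b c. map b v @ map c v \<in> Q rank"])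
    show "map a v \<in> Q ?inv" using ini prems(7) by (simp only: constraint_simps prems(5))
  qed (use step chain in blast)+
qed

section \<open>Completeness\<close>

definition agree :: "nat \<Rightarrow> (qsym \<Rightarrow> 'd list set) \<Rightarrow> (qsym \<Rightarrow> 'd list set) \<Rightarrow> bool" where
  "agree k Q Q' \<longleftrightarrow> (\<forall>q. qid q < k \<longrightarrow> Q' q = Q q)"

definition respects_arity :: "(qsym \<Rightarrow> 'd list set) \<Rightarrow> bool" where
  "respects_arity Q \<longleftrightarrow> (\<forall>q. \<forall>ds\<in>Q q. length ds = arity q)"

text \<open>
  Quantifying over all \<open>Q'\<close> that agree with the witness below \<open>k'\<close> expresses, without any syntactic
  bookkeeping, that the constraints mention only query symbols below \<open>k'\<close>.
\<close>

definition extendable where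
  "extendable T k Q cs k' \<longleftrightarrow> k \<le> k' \<and> (\<exists>Q1. agree k Q Q1 \<and> respects_arity Q1 \<and>
     (\<forall>Q'. agree k' Q1 Q' \<longrightarrow> (\<forall>c\<in>set cs. sat_constraint T Q' c)))"

lemma agree_trans: "agree k Q Q' \<Longrightarrow> agree k' Q' Q'' \<Longrightarrow> k \<le> k' \<Longrightarrow> agree k Q Q''"
  by (simp add: agree_def)

lemma agree_mono: "agree k' Q Q' \<Longrightarrow> k \<le> k' \<Longrightarrow> agree k Q Q'"
  by (simp add: agree_def)

lemma agree_refl [simp]: "agree k Q Q"
  by (simp add: agree_def)

lemma agreeD: "agree k Q Q' \<Longrightarrow> qid q < k \<Longrightarrow> Q' q = Q q"
  by (simp add: agree_def)

lemma respects_arity_upd: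
  "respects_arity Q \<Longrightarrow> (\<And>ds. ds \<in> D \<Longrightarrow> length ds = arity q) \<Longrightarrow> respects_arity (Q(q := D))"
  by (simp add: respects_arity_def)

lemma agree_upd: "agree k Q Q' \<Longrightarrow> k \<le> qid q \<Longrightarrow> agree k Q (Q'(q := D))"
  by (auto simp: agree_def)

text \<open>\<open>Q1\<close> interprets the symbols from \<open>k\<close> up to \<open>k1\<close>.
  The constraints in \<open>cs0\<close> hold whatever later symbols denote, so the interpretation
  can be completed for \<open>cs\<close> afterwards.\<close>

lemma extendable_new:
  assumes "agree k Q Q1" and "k \<le> k1"
    and "\<And>Q' c. agree k1 Q1 Q' \<Longrightarrow> c \<in> set cs0 \<Longrightarrow> sat_constraint T Q' c"
    and "extendable T k1 Q1 cs k'"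
  shows "extendable T k Q (cs0 @ cs) k'"
proof -
  from assms(4) obtain Q2 where k: "k1 \<le> k'" and Q2: "agree k1 Q1 Q2" "respects_arity Q2"
    "\<And>Q' c. agree k' Q2 Q' \<Longrightarrow> c \<in> set cs \<Longrightarrow> sat_constraint T Q' c"
    by (auto simp: extendable_def)
  have "sat_constraint T Q' c" if "agree k' Q2 Q'" "c \<in> set (cs0 @ cs)" for Q' c
    using assms(3)[of Q' c] Q2(3)[of Q' c] agree_trans[OF Q2(1), of k1 Q'] agree_mono[OF that(1) k] that
    by auto
  moreover have "agree k Q Q2" using agree_trans assms(1,2) Q2(1) by blast
  ultimately show ?thesis unfolding extendable_def using Q2(2) k assms(2) by force
qed

text \<open>The second sequence must cope with whatever the first one chose. In return it alters
  only identifiers from \<open>k1\<close> on, which leaves the first sequence satisfied.\<close>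

lemma extendable_append:
  assumes "extendable T k Q cs1 k1"
    and "\<And>Q1. agree k Q Q1 \<Longrightarrow> respects_arity Q1 \<Longrightarrow> extendable T k1 Q1 cs2 k2"
  shows "extendable T k Q (cs1 @ cs2) k2"
proof -
  from assms(1) obtain Q1 where "k \<le> k1" "agree k Q Q1" "respects_arity Q1"
    "\<And>Q' c. agree k1 Q1 Q' \<Longrightarrow> c \<in> set cs1 \<Longrightarrow> sat_constraint T Q' c"
    by (auto simp: extendable_def)
  with assms(2) show ?thesis by (intro extendable_new[of k Q Q1 k1]) blast+
qed

lemma extendable_sat:
  assumes "respects_arity Q"
    and "\<And>Q' c. agree k Q Q' \<Longrightarrow> c \<in> set cs \<Longrightarrow> sat_constraint T Q' c"
  shows "extendable T k Q cs k"
  unfolding extendable_def using assms by (metis agree_refl order_refl)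

text \<open>The transition formula contains no query symbols, so its meaning is the same under every
  \<open>Q'\<close>. The initial condition may contain symbols introduced earlier, all with
  identifiers below \<open>k\<close>, so its meaning is fixed only by agreement below
  \<open>k\<close>.\<close>

lemma gen_complete:
  fixes \<phi> :: "('f, 'p, 'x) sform"
  assumes "v = pvars P @ xs" and "in_scope P xs \<phi>" and "respects_arity Q"
    and "\<And>Q' a b. holds (expand T Q') (case_pvar a b) nxt \<longleftrightarrow> vstep T P xs a b"
    and "\<And>Q' a b. agree k Q Q' \<Longrightarrow> holds (expand T Q') (case_pvar a b) ini \<longleftrightarrow> J a"
    and "\<And>a. J a \<Longrightarrow> vsat T P \<phi> xs a"
  shows "extendable T k Q (fst (gen \<phi> v ini nxt k)) (snd (gen \<phi> v ini nxt k))"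
  using assms
proof (induction \<phi> arbitrary: xs v ini nxt k J Q rule: sform_flat_induct)
  case (Forall x \<phi>)
  note prems = Forall.prems
  have x: "in_scope P (xs @ [x]) \<phi>" "x \<notin> set (pvars P)"
    using prems(2) by (auto simp: in_scope_simps)
  show ?case unfolding gen_unfold
  proof (rule Forall.IH[where J = J, OF _ x(1) prems(3) holds_frozen_next[OF prems(4)] prems(5)])
    \<comment> \<open>The value \<open>a x\<close> is one instance of the universal quantifier, and
      with it the update is the identity.\<close>
    show "vsat T P \<phi> (xs @ [x]) a" if "J a" for a
      using prems(6)[OF that] unfolding vsat_Forall[OF x(2)] by (metis fun_upd_triv)
  qed (simp_all add: prems(1))
next
  case (Exists x \<phi>)
  note prems = Exists.prems
  have x: "in_scope P (xs @ [x]) \<phi>" "x \<notin> set (pvars P)"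
    using prems(2) by (auto simp: in_scope_simps)
  define v1 where "v1 = v @ [x]"
  have v1: "v1 = pvars P @ (xs @ [x])" by (simp add: v1_def prems(1))
  define aux where "aux = QSym k (length v1)"
  define Q1 where "Q1 = Q(aux := tuples v1 (vsat T P \<phi> (xs @ [x])))"
  have Q1: "respects_arity Q1" "agree k Q Q1"
    by (simp_all add: Q1_def aux_def respects_arity_upd agree_upd prems(3) length_tuples)
  have aux: "map a v1 \<in> Q' aux \<longleftrightarrow> vsat T P \<phi> (xs @ [x]) a" if "agree (k + 1) Q1 Q'" for Q' a
    using agreeD[OF that, of aux] in_tuples[of v1 "vsat T P \<phi> (xs @ [x])" a, OF vsat_cong] v1
    by (simp add: aux_def Q1_def)
  show ?case unfolding gen_unfold
  proof (fold v1_def, fold aux_def, rule extendable_new[OF Q1(2)])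
    show "extendable T (k + 1) Q1 (fst (gen \<phi> v1 (q0 aux v1) (AndF nxt (frozen x)) (k + 1)))
        (snd (gen \<phi> v1 (q0 aux v1) (AndF nxt (frozen x)) (k + 1)))"
      by (rule Exists.IH[where J = "vsat T P \<phi> (xs @ [x])", OF v1 x(1) Q1(1) holds_frozen_next[OF prems(4)]])
        (simp_all only: holds_q0 aux)
    show "sat_constraint T Q' c" if Q': "agree (k + 1) Q1 Q'"
      and c: "c \<in> set [Imp ini (ExF (Unprimed x) (q0 aux v1))]" for Q' c
    proof -
      have "agree k Q Q'" using agree_trans[OF Q1(2) Q'] by simp
      note ini = prems(5)[OF this]
      have "sat_constraint T Q' (Imp ini (ExF (Unprimed x) (q0 aux v1)))"
        unfolding constraint_simps holds_ExF_Unprimed ini aux[OF Q']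
        using prems(6) vsat_Exists[OF x(2)] by blast
      with c show ?thesis by simp
    qed
  qed simp
next
  case (Assn c)
  have inj: "inj Unprimed" by (simp add: inj_def)
  have fv: "fv c \<subseteq> set (pvars P @ xs)" using Assn.prems(2) by (simp add: in_scope_def)
  show ?case unfolding gen_unfold
  proof (rule extendable_sat[OF Assn.prems(3)])
    fix Q' c' assume Q': "agree k Q Q'" and "c' \<in> set [Imp ini (map_fm (\<lambda>f. f) Inl Unprimed c)]"
    moreover have "holds T a c" if "J a" for a
      using Assn.prems(6)[OF that] vsat_Assn[OF fv] by blast
    then have "sat_constraint T Q' (Imp ini (map_fm (\<lambda>f. f) Inl Unprimed c))"
      unfolding sat_Imp holds_expand_map[OF inj] Assn.prems(5)[OF Q'] by (simp add: comp_def)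
    ultimately show "sat_constraint T Q' c'" by simp
  qed
next
  case (Conj \<phi> \<psi>)
  note prems = Conj.prems
  have scope: "in_scope P xs \<phi>" "in_scope P xs \<psi>" using prems(2) by (simp_all only: in_scope_simps)
  define aux1 where "aux1 = QSym k (length v)"
  define aux2 where "aux2 = QSym (k + 1) (length v)"
  define Q1 where "Q1 = Q(aux1 := tuples v (vsat T P \<phi> xs), aux2 := tuples v (vsat T P \<psi> xs))"
  have Q1: "respects_arity Q1" "agree k Q Q1"
    by (simp_all add: Q1_def aux1_def aux2_def respects_arity_upd agree_upd prems(3) length_tuples)
  have aux1: "map a v \<in> Q' aux1 \<longleftrightarrow> vsat T P \<phi> xs a" if "agree (k + 2) Q1 Q'" for Q' a
    using agreeD[OF that, of aux1] in_tuples[of v "vsat T P \<phi> xs" a, OF vsat_cong] prems(1)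
    by (simp add: aux1_def aux2_def Q1_def)
  have aux2: "map a v \<in> Q' aux2 \<longleftrightarrow> vsat T P \<psi> xs a" if "agree (k + 2) Q1 Q'" for Q' a
    using agreeD[OF that, of aux2] in_tuples[of v "vsat T P \<psi> xs" a, OF vsat_cong] prems(1)
    by (simp add: aux2_def Q1_def)
  let ?g = "gen \<phi> v (q0 aux1 v) nxt (k + 2)"
  have g: "extendable T (k + 2) Q1 (fst ?g) (snd ?g)"
    by (rule Conj.IH(1)[where J = "vsat T P \<phi> xs", OF prems(1) scope(1) Q1(1) prems(4)])
      (simp_all only: holds_q0 aux1)
  \<comment> \<open>Identifiers only grow, so the meaning chosen for \<open>aux2\<close> is still in
    force when the constraints of \<psi> are treated.\<close>
  then have le: "k + 2 \<le> snd ?g" by (simp add: extendable_def)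
  show ?case unfolding gen_unfold
  proof (fold aux1_def, fold aux2_def,
      rule extendable_new[OF Q1(2) _ _ extendable_append[OF g]])
    show "extendable T (snd ?g) Q2 (fst (gen \<psi> v (q0 aux2 v) nxt (snd ?g)))
        (snd (gen \<psi> v (q0 aux2 v) nxt (snd ?g)))"
      if "agree (k + 2) Q1 Q2" "respects_arity Q2" for Q2
      by (rule Conj.IH(2)[where J = "vsat T P \<psi> xs", OF prems(1) scope(2) that(2) prems(4)])
        (simp_all only: holds_q0 aux2[OF agree_trans[OF that(1) _ le]])
    show "sat_constraint T Q' c" if Q': "agree (k + 2) Q1 Q'"
      and c: "c \<in> set [Imp ini (AndF (q0 aux1 v) (q0 aux2 v))]" for Q' c
    proof -
      have "agree k Q Q'" using agree_trans[OF Q1(2) Q'] by simp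
      note ini = prems(5)[OF this]
      have "sat_constraint T Q' (Imp ini (AndF (q0 aux1 v) (q0 aux2 v)))"
        unfolding constraint_simps ini aux1[OF Q'] aux2[OF Q'] using prems(6) vsat_Conj by blast
      with c show ?thesis by simp
    qed
  qed simp
next
  case (Disj \<phi> \<psi>)
  note prems = Disj.prems
  have scope: "in_scope P xs \<phi>" "in_scope P xs \<psi>" using prems(2) by (simp_all only: in_scope_simps)
  define aux1 where "aux1 = QSym k (length v)"
  define aux2 where "aux2 = QSym (k + 1) (length v)"
  define Q1 where "Q1 = Q(aux1 := tuples v (vsat T P \<phi> xs), aux2 := tuples v (vsat T P \<psi> xs))"
  have Q1: "respects_arity Q1" "agree k Q Q1"
    by (simp_all add: Q1_def aux1_def aux2_def respects_arity_upd agree_upd prems(3) length_tuples)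
  have aux1: "map a v \<in> Q' aux1 \<longleftrightarrow> vsat T P \<phi> xs a" if "agree (k + 2) Q1 Q'" for Q' a
    using agreeD[OF that, of aux1] in_tuples[of v "vsat T P \<phi> xs" a, OF vsat_cong] prems(1)
    by (simp add: aux1_def aux2_def Q1_def)
  have aux2: "map a v \<in> Q' aux2 \<longleftrightarrow> vsat T P \<psi> xs a" if "agree (k + 2) Q1 Q'" for Q' a
    using agreeD[OF that, of aux2] in_tuples[of v "vsat T P \<psi> xs" a, OF vsat_cong] prems(1)
    by (simp add: aux2_def Q1_def)
  let ?g = "gen \<phi> v (q0 aux1 v) nxt (k + 2)"
  have g: "extendable T (k + 2) Q1 (fst ?g) (snd ?g)"
    by (rule Disj.IH(1)[where J = "vsat T P \<phi> xs", OF prems(1) scope(1) Q1(1) prems(4)])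
      (simp_all only: holds_q0 aux1)
  then have le: "k + 2 \<le> snd ?g" by (simp add: extendable_def)
  show ?case unfolding gen_unfold
  proof (fold aux1_def, fold aux2_def,
      rule extendable_new[OF Q1(2) _ _ extendable_append[OF g]])
    show "extendable T (snd ?g) Q2 (fst (gen \<psi> v (q0 aux2 v) nxt (snd ?g)))
        (snd (gen \<psi> v (q0 aux2 v) nxt (snd ?g)))"
      if "agree (k + 2) Q1 Q2" "respects_arity Q2" for Q2
      by (rule Disj.IH(2)[where J = "vsat T P \<psi> xs", OF prems(1) scope(2) that(2) prems(4)])
        (simp_all only: holds_q0 aux2[OF agree_trans[OF that(1) _ le]])
    show "sat_constraint T Q' c" if Q': "agree (k + 2) Q1 Q'"
      and c: "c \<in> set [Imp ini (OrF (q0 aux1 v) (q0 aux2 v))]" for Q' c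
    proof -
      have "agree k Q Q'" using agree_trans[OF Q1(2) Q'] by simp
      note ini = prems(5)[OF this]
      have "sat_constraint T Q' (Imp ini (OrF (q0 aux1 v) (q0 aux2 v)))"
        unfolding constraint_simps ini aux1[OF Q'] aux2[OF Q'] using prems(6) vsat_Disj by blast
      with c show ?thesis by simp
    qed
  qed simp
next
  case (AX \<phi>)
  note prems = AX.prems
  have scope: "in_scope P xs \<phi>" using prems(2) by (simp only: in_scope_simps)
  then have disj: "set xs \<inter> set (pvars P) = {}" by (simp add: in_scope_def)
  define aux where "aux = QSym k (length v)"
  define Q1 where "Q1 = Q(aux := tuples v (vsat T P \<phi> xs))"
  have Q1: "respects_arity Q1" "agree k Q Q1"
    by (simp_all add: Q1_def aux_def respects_arity_upd agree_upd prems(3) length_tuples)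
  have aux: "map a v \<in> Q' aux \<longleftrightarrow> vsat T P \<phi> xs a" if "agree (k + 1) Q1 Q'" for Q' a
    using agreeD[OF that, of aux] in_tuples[of v "vsat T P \<phi> xs" a, OF vsat_cong] prems(1)
    by (simp add: aux_def Q1_def)
  show ?case unfolding gen_unfold
  proof (fold aux_def, rule extendable_new[OF Q1(2)])
    show "extendable T (k + 1) Q1 (fst (gen \<phi> v (q0 aux v) nxt (k + 1)))
        (snd (gen \<phi> v (q0 aux v) nxt (k + 1)))"
      by (rule AX.IH[where J = "vsat T P \<phi> xs", OF prems(1) scope Q1(1) prems(4)])
        (simp_all only: holds_q0 aux)
    show "sat_constraint T Q' c" if Q': "agree (k + 1) Q1 Q'"
      and c: "c \<in> set [Imp ini (Ex_primed v nxt), Imp (AndF ini nxt) (q1 aux v)]" for Q' c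
    proof -
      have "agree k Q Q'" using agree_trans[OF Q1(2) Q'] by simp
      note ini = prems(5)[OF this]
      have "sat_constraint T Q' (Imp ini (Ex_primed v nxt))"
        "sat_constraint T Q' (Imp (AndF ini nxt) (q1 aux v))"
        unfolding constraint_simps ini prems(4) holds_Ex_next[OF prems(1,4)] aux[OF Q']
        using prems(6) vsat_AX[OF disj] by blast+
      with c show ?thesis by auto
    qed
  qed simp
next
  case (AG \<phi>)
  note prems = AG.prems
  have scope: "in_scope P xs \<phi>" using prems(2) by (simp only: in_scope_simps)
  then have disj: "set xs \<inter> set (pvars P) = {}" by (simp add: in_scope_def)
  define inv where "inv = QSym k (length v)"
  \<comment> \<open>The invariant stands for the whole temporal formula: \<phi> alone need not be
    preserved by steps.\<close>
  let ?I = "vsat T P (A (G \<phi>)) xs"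
  define Q1 where "Q1 = Q(inv := tuples v ?I)"
  have Q1: "respects_arity Q1" "agree k Q Q1"
    by (simp_all add: Q1_def inv_def respects_arity_upd agree_upd prems(3) length_tuples)
  have inv: "map a v \<in> Q' inv \<longleftrightarrow> ?I a" if "agree (k + 1) Q1 Q'" for Q' a
    using agreeD[OF that, of inv] in_tuples[of v ?I a, OF vsat_cong] prems(1)
    by (simp add: inv_def Q1_def)
  show ?case unfolding gen_unfold
  proof (fold inv_def, rule extendable_new[OF Q1(2)])
    show "extendable T (k + 1) Q1 (fst (gen \<phi> v (q0 inv v) nxt (k + 1)))
        (snd (gen \<phi> v (q0 inv v) nxt (k + 1)))"
    proof (rule AG.IH[where J = ?I, OF prems(1) scope Q1(1) prems(4)])
      show "vsat T P \<phi> xs a" if "?I a" for a using vsat_AG_unfold(1)[OF disj that] .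
    qed (simp_all only: holds_q0 inv)
    show "sat_constraint T Q' c" if Q': "agree (k + 1) Q1 Q'"
      and c: "c \<in> set [Imp ini (q0 inv v), Imp (AndF (q0 inv v) nxt) (q1 inv v)]" for Q' c
    proof -
      have "agree k Q Q'" using agree_trans[OF Q1(2) Q'] by simp
      note ini = prems(5)[OF this]
      have "sat_constraint T Q' (Imp ini (q0 inv v))"
        "sat_constraint T Q' (Imp (AndF (q0 inv v) nxt) (q1 inv v))"
        unfolding constraint_simps ini prems(4) inv[OF Q']
        using prems(6) vsat_AG_unfold(2)[OF disj] by blast+
      with c show ?thesis by auto
    qed
  qed simp
next
  case (AU \<phi> \<psi>)
  note prems = AU.prems
  have scope: "in_scope P xs \<phi>" "in_scope P xs \<psi>" using prems(2) by (simp_all only: in_scope_simps)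
  then have disj: "set xs \<inter> set (pvars P) = {}" by (simp add: in_scope_def)
  define inv where "inv = QSym k (length v)"
  define aux1 where "aux1 = QSym (k + 1) (length v)"
  define aux2 where "aux2 = QSym (k + 2) (length v)"
  define rank where "rank = QSym (k + 3) (2 * length v)"
  note syms = inv_def aux1_def aux2_def rank_def
  let ?I = "vsat T P (A (U \<phi> \<psi>)) xs"
  \<comment> \<open>Restriction to \<open>?I\<close> keeps this relation well-founded; elsewhere
    there may be runs on which \<psi> stays pending forever.\<close>
  let ?R = "\<lambda>a b. ?I a \<and> \<not> vsat T P \<psi> xs a \<and> vstep T P xs a b"
  define Q1 where "Q1 = Q(inv := tuples v ?I, aux1 := tuples v (vsat T P \<phi> xs),
    aux2 := tuples v (vsat T P \<psi> xs), rank := tuples2 v ?R)"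
  have Q1: "respects_arity Q1" "agree k Q Q1"
    by (simp_all add: Q1_def syms respects_arity_upd agree_upd prems(3) length_tuples length_tuples2)
  have R_cong: "?R a b \<longleftrightarrow> ?R a' b'" if "map a v = map a' v" "map b v = map b' v" for a a' b b'
    using that vsat_cong[of a P xs a' T] vstep_cong[of a P xs a' b b' T] unfolding prems(1) by metis
  have inv: "map a v \<in> Q' inv \<longleftrightarrow> ?I a" if "agree (k + 4) Q1 Q'" for Q' a
    using agreeD[OF that, of inv] in_tuples[of v ?I a, OF vsat_cong] prems(1)
    by (simp add: syms Q1_def)
  have aux1: "map a v \<in> Q' aux1 \<longleftrightarrow> vsat T P \<phi> xs a" if "agree (k + 4) Q1 Q'" for Q' a
    using agreeD[OF that, of aux1] in_tuples[of v "vsat T P \<phi> xs" a, OF vsat_cong] prems(1)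
    by (simp add: syms Q1_def)
  have aux2: "map a v \<in> Q' aux2 \<longleftrightarrow> vsat T P \<psi> xs a" if "agree (k + 4) Q1 Q'" for Q' a
    using agreeD[OF that, of aux2] in_tuples[of v "vsat T P \<psi> xs" a, OF vsat_cong] prems(1)
    by (simp add: syms Q1_def)
  \<comment> \<open>For the rank the set itself is recorded, because the \<open>Wf\<close>
    constraint ranges over arbitrary lists and not only over tuples of given valuations.\<close>
  have Q'_rank: "Q' rank = tuples2 v ?R" if "agree (k + 4) Q1 Q'" for Q'
    using agreeD[OF that, of rank] by (simp add: syms Q1_def)
  have rank: "map a v @ map b v \<in> tuples2 v ?R \<longleftrightarrow> ?R a b" for a b
    by (rule in_tuples2) (rule R_cong)
  let ?g = "gen \<phi> v (q0 aux1 v) nxt (k + 4)"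
  have g: "extendable T (k + 4) Q1 (fst ?g) (snd ?g)"
    by (rule AU.IH(1)[where J = "vsat T P \<phi> xs", OF prems(1) scope(1) Q1(1) prems(4)])
      (simp_all only: holds_q0 aux1)
  then have le: "k + 4 \<le> snd ?g" by (simp add: extendable_def)
  show ?case unfolding gen_unfold
  proof (fold inv_def, fold aux1_def, fold aux2_def, fold rank_def,
      rule extendable_new[OF Q1(2) _ _ extendable_append[OF g]])
    show "extendable T (snd ?g) Q2 (fst (gen \<psi> v (q0 aux2 v) nxt (snd ?g)))
        (snd (gen \<psi> v (q0 aux2 v) nxt (snd ?g)))"
      if "agree (k + 4) Q1 Q2" "respects_arity Q2" for Q2
      by (rule AU.IH(2)[where J = "vsat T P \<psi> xs", OF prems(1) scope(2) that(2) prems(4)])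
        (simp_all only: holds_q0 aux2[OF agree_trans[OF that(1) _ le]])
    show "sat_constraint T Q' c" if Q': "agree (k + 4) Q1 Q'"
      and c: "c \<in> set [Imp ini (q0 inv v),
        Imp (AndF (q0 inv v) (NotF (q0 aux2 v))) (AndF (q0 aux1 v) (Ex_primed v nxt)),
        Imp (AndF (AndF (q0 inv v) (NotF (q0 aux2 v))) nxt) (AndF (q1 inv v) (q01 rank v)),
        Wf rank]" for Q' c
    proof -
      have "agree k Q Q'" using agree_trans[OF Q1(2) Q'] by simp
      note ini = prems(5)[OF this]
      have "sat_constraint T Q' (Imp ini (q0 inv v))"
        unfolding constraint_simps ini inv[OF Q'] using prems(6) by blast
      moreover have "sat_constraint T Q'
          (Imp (AndF (q0 inv v) (NotF (q0 aux2 v))) (AndF (q0 aux1 v) (Ex_primed v nxt)))"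
        unfolding constraint_simps holds_Ex_next[OF prems(1,4)] inv[OF Q'] aux1[OF Q'] aux2[OF Q']
        using vsat_AU_unfold(1,2)[OF disj] by blast
      moreover have "sat_constraint T Q'
          (Imp (AndF (AndF (q0 inv v) (NotF (q0 aux2 v))) nxt) (AndF (q1 inv v) (q01 rank v)))"
        unfolding constraint_simps prems(4) inv[OF Q'] aux2[OF Q'] Q'_rank[OF Q'] rank
        using vsat_AU_unfold(3)[OF disj] by blast
      moreover have "sat_constraint T Q' (Wf rank :: ('f, 'p, 'x) constraint)"
      proof (rule sat_Wf_tuples2[of v ?R Q' rank, OF _ Q'_rank[OF Q']])
        show "?R a b \<longleftrightarrow> ?R a' b'" if "map a v = map a' v" "map b v = map b' v" for a a' b b'
          using R_cong[OF that] .
        show "\<not> (\<exists>u. \<forall>i. ?R (u i) (u (Suc i)))" using vsat_AU_no_chain[OF disj] by blast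
      qed (simp_all add: rank_def)
      ultimately show ?thesis using c by auto
    qed
  qed simp
next
  case (EX \<phi>)
  note prems = EX.prems
  have scope: "in_scope P xs \<phi>" using prems(2) by (simp only: in_scope_simps)
  then have disj: "set xs \<inter> set (pvars P) = {}" by (simp add: in_scope_def)
  define aux where "aux = QSym k (length v)"
  define Q1 where "Q1 = Q(aux := tuples v (vsat T P \<phi> xs))"
  have Q1: "respects_arity Q1" "agree k Q Q1"
    by (simp_all add: Q1_def aux_def respects_arity_upd agree_upd prems(3) length_tuples)
  have aux: "map a v \<in> Q' aux \<longleftrightarrow> vsat T P \<phi> xs a" if "agree (k + 1) Q1 Q'" for Q' a
    using agreeD[OF that, of aux] in_tuples[of v "vsat T P \<phi> xs" a, OF vsat_cong] prems(1)
    by (simp add: aux_def Q1_def)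
  show ?case unfolding gen_unfold
  proof (fold aux_def, rule extendable_new[OF Q1(2)])
    show "extendable T (k + 1) Q1 (fst (gen \<phi> v (q0 aux v) nxt (k + 1)))
        (snd (gen \<phi> v (q0 aux v) nxt (k + 1)))"
      by (rule EX.IH[where J = "vsat T P \<phi> xs", OF prems(1) scope Q1(1) prems(4)])
        (simp_all only: holds_q0 aux)
    show "sat_constraint T Q' c" if Q': "agree (k + 1) Q1 Q'"
      and c: "c \<in> set [Imp ini (Ex_primed v (AndF nxt (q1 aux v)))]" for Q' c
    proof -
      have "agree k Q Q'" using agree_trans[OF Q1(2) Q'] by simp
      note ini = prems(5)[OF this]
      have "sat_constraint T Q' (Imp ini (Ex_primed v (AndF nxt (q1 aux v))))"
        unfolding constraint_simps ini holds_Ex_next[OF prems(1,4)] aux[OF Q']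
        using prems(6) vsat_EX[OF disj] by blast
      with c show ?thesis by auto
    qed
  qed simp
next
  case (EG \<phi>)
  note prems = EG.prems
  have scope: "in_scope P xs \<phi>" using prems(2) by (simp only: in_scope_simps)
  then have disj: "set xs \<inter> set (pvars P) = {}" by (simp add: in_scope_def)
  define inv where "inv = QSym k (length v)"
  let ?I = "vsat T P (E (G \<phi>)) xs"
  define Q1 where "Q1 = Q(inv := tuples v ?I)"
  have Q1: "respects_arity Q1" "agree k Q Q1"
    by (simp_all add: Q1_def inv_def respects_arity_upd agree_upd prems(3) length_tuples)
  have inv: "map a v \<in> Q' inv \<longleftrightarrow> ?I a" if "agree (k + 1) Q1 Q'" for Q' a
    using agreeD[OF that, of inv] in_tuples[of v ?I a, OF vsat_cong] prems(1)
    by (simp add: inv_def Q1_def)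
  show ?case unfolding gen_unfold
  proof (fold inv_def, rule extendable_new[OF Q1(2)])
    show "extendable T (k + 1) Q1 (fst (gen \<phi> v (q0 inv v) nxt (k + 1)))
        (snd (gen \<phi> v (q0 inv v) nxt (k + 1)))"
    proof (rule EG.IH[where J = ?I, OF prems(1) scope Q1(1) prems(4)])
      show "vsat T P \<phi> xs a" if "?I a" for a using vsat_EG_unfold(1)[OF disj that] .
    qed (simp_all only: holds_q0 inv)
    show "sat_constraint T Q' c" if Q': "agree (k + 1) Q1 Q'"
      and c: "c \<in> set [Imp ini (q0 inv v),
        Imp (AndF (q0 inv v) nxt) (Ex_primed v (AndF nxt (q1 inv v)))]" for Q' c
    proof -
      have "agree k Q Q'" using agree_trans[OF Q1(2) Q'] by simp
      note ini = prems(5)[OF this]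
      have "sat_constraint T Q' (Imp ini (q0 inv v))"
        unfolding constraint_simps ini inv[OF Q'] using prems(6) by blast
      moreover have "sat_constraint T Q'
          (Imp (AndF (q0 inv v) nxt) (Ex_primed v (AndF nxt (q1 inv v))))"
        unfolding constraint_simps prems(4) holds_Ex_next[OF prems(1,4)] inv[OF Q']
        using vsat_EG_unfold(2)[OF disj] by blast
      ultimately show ?thesis using c by auto
    qed
  qed simp
next
  case (EU \<phi> \<psi>)
  note prems = EU.prems
  have scope: "in_scope P xs \<phi>" "in_scope P xs \<psi>" using prems(2) by (simp_all only: in_scope_simps)
  then have disj: "set xs \<inter> set (pvars P) = {}" by (simp add: in_scope_def)
  define inv where "inv = QSym k (length v)"
  let ?I = "vsat T P (E (U \<phi> \<psi>)) xs" and ?d = "vdist T P xs \<phi> \<psi>"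
  \<comment> \<open>Pending steps would not do as a rank here: only some path has to reach \<psi>,
    and others may go on forever. The distance drops along a suitable choice of successors.\<close>
  let ?R = "\<lambda>a b. ?d b < ?d a"
  have R_cong: "?R a b \<longleftrightarrow> ?R a' b'" if "map a v = map a' v" "map b v = map b' v" for a a' b b'
    using that vdist_cong[OF disj] unfolding prems(1) by metis
  have rank: "map a v @ map b v \<in> tuples2 v ?R \<longleftrightarrow> ?R a b" for a b
    by (rule in_tuples2) (rule R_cong)
  have chain: "\<not> (\<exists>u. \<forall>i::nat. ?R (u i) (u (Suc i)))"
  proof
    assume "\<exists>u. \<forall>i::nat. ?R (u i) (u (Suc i))"
    then obtain u where "\<forall>i::nat. (?d (u (Suc i)), ?d (u i)) \<in> less_than" by auto
    then show False using wf_less_than unfolding wf_iff_no_infinite_down_chain not_ex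
      by (blast dest: spec[of _ "\<lambda>i. ?d (u i)"])
  qed
  show ?case
  proof (cases "\<phi> = Assn TrueF")
    case True
    define aux where "aux = QSym (k + 1) (length v)"
    define rank where "rank = QSym (k + 2) (2 * length v)"
    note syms = inv_def aux_def rank_def
    define Q1 where "Q1 = Q(inv := tuples v ?I, aux := tuples v (vsat T P \<psi> xs),
      rank := tuples2 v ?R)"
    have Q1: "respects_arity Q1" "agree k Q Q1"
      by (simp_all add: Q1_def syms respects_arity_upd agree_upd prems(3) length_tuples length_tuples2)
    have inv: "map a v \<in> Q' inv \<longleftrightarrow> ?I a" if "agree (k + 3) Q1 Q'" for Q' a
      using agreeD[OF that, of inv] in_tuples[of v ?I a, OF vsat_cong] prems(1)
      by (simp add: syms Q1_def)
    have aux: "map a v \<in> Q' aux \<longleftrightarrow> vsat T P \<psi> xs a" if "agree (k + 3) Q1 Q'" for Q' a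
      using agreeD[OF that, of aux] in_tuples[of v "vsat T P \<psi> xs" a, OF vsat_cong] prems(1)
      by (simp add: syms Q1_def)
    have Q'_rank: "Q' rank = tuples2 v ?R" if "agree (k + 3) Q1 Q'" for Q'
      using agreeD[OF that, of rank] by (simp add: syms Q1_def)
    show ?thesis unfolding gen_unfold if_P[OF True]
    proof (fold inv_def, fold aux_def, fold rank_def, rule extendable_new[OF Q1(2)])
      show "extendable T (k + 3) Q1 (fst (gen \<psi> v (q0 aux v) nxt (k + 3)))
          (snd (gen \<psi> v (q0 aux v) nxt (k + 3)))"
        by (rule EU.IH(2)[where J = "vsat T P \<psi> xs", OF prems(1) scope(2) Q1(1) prems(4)])
          (simp_all only: holds_q0 aux)
      show "sat_constraint T Q' c" if Q': "agree (k + 3) Q1 Q'"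
        and c: "c \<in> set [Imp ini (q0 inv v),
          Imp (AndF (q0 inv v) (NotF (q0 aux v)))
            (Ex_primed v (AndF nxt (AndF (q1 inv v) (q01 rank v)))),
          Wf rank]" for Q' c
      proof -
        have "agree k Q Q'" using agree_trans[OF Q1(2) Q'] by simp
        note ini = prems(5)[OF this]
        have "sat_constraint T Q' (Imp ini (q0 inv v))"
          unfolding constraint_simps ini inv[OF Q'] using prems(6) by blast
        moreover have "sat_constraint T Q' (Imp (AndF (q0 inv v) (NotF (q0 aux v)))
            (Ex_primed v (AndF nxt (AndF (q1 inv v) (q01 rank v)))))"
          unfolding constraint_simps holds_Ex_next[OF prems(1,4)] inv[OF Q'] aux[OF Q'] Q'_rank[OF Q'] rank
          using vsat_EU_unfold(2)[OF disj] by blast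
        moreover have "sat_constraint T Q' (Wf rank :: ('f, 'p, 'x) constraint)"
          by (rule sat_Wf_tuples2[of v ?R Q' rank, OF _ Q'_rank[OF Q'] _ chain], rule R_cong) (simp_all add: rank_def)
        ultimately show ?thesis using c by auto
      qed
    qed simp
  next
    case False
    define aux1 where "aux1 = QSym (k + 1) (length v)"
    define aux2 where "aux2 = QSym (k + 2) (length v)"
    define rank where "rank = QSym (k + 3) (2 * length v)"
    note syms = inv_def aux1_def aux2_def rank_def
    define Q1 where "Q1 = Q(inv := tuples v ?I, aux1 := tuples v (vsat T P \<phi> xs),
      aux2 := tuples v (vsat T P \<psi> xs), rank := tuples2 v ?R)"
    have Q1: "respects_arity Q1" "agree k Q Q1"
      by (simp_all add: Q1_def syms respects_arity_upd agree_upd prems(3) length_tuples length_tuples2)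
    have inv: "map a v \<in> Q' inv \<longleftrightarrow> ?I a" if "agree (k + 4) Q1 Q'" for Q' a
      using agreeD[OF that, of inv] in_tuples[of v ?I a, OF vsat_cong] prems(1)
      by (simp add: syms Q1_def)
    have aux1: "map a v \<in> Q' aux1 \<longleftrightarrow> vsat T P \<phi> xs a" if "agree (k + 4) Q1 Q'" for Q' a
      using agreeD[OF that, of aux1] in_tuples[of v "vsat T P \<phi> xs" a, OF vsat_cong] prems(1)
      by (simp add: syms Q1_def)
    have aux2: "map a v \<in> Q' aux2 \<longleftrightarrow> vsat T P \<psi> xs a" if "agree (k + 4) Q1 Q'" for Q' a
      using agreeD[OF that, of aux2] in_tuples[of v "vsat T P \<psi> xs" a, OF vsat_cong] prems(1)
      by (simp add: syms Q1_def)
    have Q'_rank: "Q' rank = tuples2 v ?R" if "agree (k + 4) Q1 Q'" for Q'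
      using agreeD[OF that, of rank] by (simp add: syms Q1_def)
    let ?g = "gen \<phi> v (q0 aux1 v) nxt (k + 4)"
    have g: "extendable T (k + 4) Q1 (fst ?g) (snd ?g)"
      by (rule EU.IH(1)[where J = "vsat T P \<phi> xs", OF prems(1) scope(1) Q1(1) prems(4)])
        (simp_all only: holds_q0 aux1)
    then have le: "k + 4 \<le> snd ?g" by (simp add: extendable_def)
    show ?thesis unfolding gen_unfold if_not_P[OF False]
    proof (fold inv_def, fold aux1_def, fold aux2_def, fold rank_def,
        rule extendable_new[OF Q1(2) _ _ extendable_append[OF g]])
      show "extendable T (snd ?g) Q2 (fst (gen \<psi> v (q0 aux2 v) nxt (snd ?g)))
          (snd (gen \<psi> v (q0 aux2 v) nxt (snd ?g)))"
        if "agree (k + 4) Q1 Q2" "respects_arity Q2" for Q2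
        by (rule EU.IH(2)[where J = "vsat T P \<psi> xs", OF prems(1) scope(2) that(2) prems(4)])
          (simp_all only: holds_q0 aux2[OF agree_trans[OF that(1) _ le]])
      show "sat_constraint T Q' c" if Q': "agree (k + 4) Q1 Q'"
        and c: "c \<in> set [Imp ini (q0 inv v),
          Imp (AndF (q0 inv v) (NotF (q0 aux2 v)))
            (AndF (q0 aux1 v) (Ex_primed v (AndF nxt (AndF (q1 inv v) (q01 rank v))))),
          Wf rank]" for Q' c
      proof -
        have "agree k Q Q'" using agree_trans[OF Q1(2) Q'] by simp
        note ini = prems(5)[OF this]
        have "sat_constraint T Q' (Imp ini (q0 inv v))"
          unfolding constraint_simps ini inv[OF Q'] using prems(6) by blast
        moreover have "sat_constraint T Q' (Imp (AndF (q0 inv v) (NotF (q0 aux2 v)))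
            (AndF (q0 aux1 v) (Ex_primed v (AndF nxt (AndF (q1 inv v) (q01 rank v))))))"
          unfolding constraint_simps holds_Ex_next[OF prems(1,4)]
            inv[OF Q'] aux1[OF Q'] aux2[OF Q'] Q'_rank[OF Q'] rank
          using vsat_EU_unfold[OF disj] by blast
        moreover have "sat_constraint T Q' (Wf rank :: ('f, 'p, 'x) constraint)"
          by (rule sat_Wf_tuples2[of v ?R Q' rank, OF _ Q'_rank[OF Q'] _ chain], rule R_cong) (simp_all add: rank_def)
        ultimately show ?thesis using c by auto
      qed
    qed simp
  qed
qed

theorem theorem1:
  fixes T :: "('f, 'p, 'd) struct"
    and P :: "('f, 'p, 'x) program"
    and \<phi> :: "('f, 'p, 'x) sform"
  assumes "wf_program P"
    and "fv_sform \<phi> \<subseteq> set (pvars P)"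
    and "no_shadow \<phi> (set (pvars P))"
  shows "satisfiable T (Gen \<phi> (pvars P) (pinit P) (pnext P)) \<longleftrightarrow> models T P \<phi>"
proof -
  let ?ini = "map_fm (\<lambda>f. f) Inl Unprimed (pinit P) :: ('f, 'p, 'x) cfm"
  let ?nxt = "map_fm (\<lambda>f. f) Inl (\<lambda>y. y) (pnext P) :: ('f, 'p, 'x) cfm"
  let ?J = "\<lambda>a :: 'x \<Rightarrow> 'd. initial T P (state_of P a)"
  have fv: "fv (pinit P) \<subseteq> set (pvars P)"
    "fv (pnext P) \<subseteq> Unprimed ` set (pvars P) \<union> Primed ` set (pvars P)"
    using assms(1) by (simp_all add: wf_program_def)
  have v: "pvars P = pvars P @ []" by simp
  have scope: "in_scope P [] \<phi>" using assms(2,3) by (simp add: in_scope_def)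
  have inj: "inj (Unprimed :: 'x \<Rightarrow> 'x pvar)" "inj (\<lambda>y :: 'x pvar. y)" by (simp_all add: inj_def)
  have ini: "holds (expand T Q) (case_pvar a b) ?ini \<longleftrightarrow> ?J a" for Q and a b :: "'x \<Rightarrow> 'd"
  proof -
    \<comment> \<open>Constraints range over all total valuations, states are undefined outside the
      program variables; the free variables of a well-formed program do not see the
      difference.\<close>
    have "holds T a (pinit P) \<longleftrightarrow> holds T (state_of P a) (pinit P)"
      using fv(1) by (intro holds_cong) (auto simp: state_of_def)
    then show ?thesis unfolding holds_expand_map[OF inj(1)] by (simp add: comp_def initial_def)
  qed
  have nxt: "holds (expand T Q) (case_pvar a b) ?nxt \<longleftrightarrow> vstep T P [] a b" for Q and a b :: "'x \<Rightarrow> 'd"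
  proof -
    have "holds T (case_pvar a b) (pnext P) \<longleftrightarrow>
        holds T (case_pvar (state_of P a) (state_of P b)) (pnext P)"
      using fv(2) by (intro holds_cong) (auto simp: state_of_def)
    then show ?thesis unfolding holds_expand_map[OF inj(2)]
      by (simp add: comp_def vstep_def step_def env_of_def)
  qed
  \<comment> \<open>A state is its own restriction, so it may serve as the valuation above
    itself.\<close>
  have init_state: "state_of P s = s" if "initial T P s" for s :: "'x \<Rightarrow> 'd"
    using that by (auto simp: initial_def states_def state_of_def fun_eq_iff)
  have models: "models T P \<phi> \<longleftrightarrow> (\<forall>a. ?J a \<longrightarrow> vsat T P \<phi> [] a)"
    unfolding models_def vsat_def env_of_def using init_state by auto metis
  have J_cong: "?J a \<longleftrightarrow> ?J b" if "map a (pvars P) = map b (pvars P)" for a b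
    using state_of_cong[of a P "[]" b] that by simp
  show ?thesis
  proof
    assume "satisfiable T (Gen \<phi> (pvars P) (pinit P) (pnext P))"
    then obtain Q where Q: "\<forall>c\<in>set (fst (gen \<phi> (pvars P) ?ini ?nxt 0)). sat_constraint T Q c"
      by (auto simp: satisfiable_def Gen_def)
    show "models T P \<phi>"
      unfolding models using gen_sound[where J = ?J, OF v scope Q nxt ini J_cong] by blast
  next
    assume "models T P \<phi>"
    \<comment> \<open>No identifier lies below 0, so the starting interpretation is arbitrary, and
      the empty one trivially respects arities.\<close>
    have "respects_arity (\<lambda>_. {} :: 'd list set)" by (simp add: respects_arity_def)
    then have "extendable T 0 (\<lambda>_. {}) (fst (gen \<phi> (pvars P) ?ini ?nxt 0))
        (snd (gen \<phi> (pvars P) ?ini ?nxt 0))"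
      by (rule gen_complete[where J = ?J, OF v scope _ nxt ini])
        (use \<open>models T P \<phi>\<close> in \<open>simp add: models\<close>)
    then show "satisfiable T (Gen \<phi> (pvars P) (pinit P) (pnext P))"
      unfolding extendable_def satisfiable_def respects_arity_def Gen_def by (metis agree_refl)
  qed
qed

end
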